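(* Let $A(n)$ be an $m \times k$ matrix and $b(n)$ a column vector of length $m$, all of whose entries are polynomials in $n$ with integer coefficients. For each $n$, let $f(n)$ denote the number of vectors $x \in \mathbf{Z}_{\ge 0}^k$ satisfying $A(n)x = b(n)$, and assume that these numbers are finite. Then $f \in \mathbf{QP}_{\gg 0}$.
   Context: A function $f \colon \mathbf{Z} \to \mathbf{Z}$ (or a function defined on all sufficiently large integers) is said to be eventually a quasi-polynomial if there exist a positive integer $s$ (a period) and polynomials $f_0,\dots,f_{s-1} \in \mathbf{Q}[t]$ such that $f(n) = f_i(n)$ for all sufficiently large $n$ with $n \equiv i \pmod s$. $\mathbf{QP}_{\gg 0}$ denotes the set of functions that are eventually quasi-polynomial. *)

theory Defs
  imports "Jordan_Normal_Form.Matrix" "HOL-Computational_Algebra.Polynomial" "HOL-Number_Theory.Cong"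
begin

text \<open>
  A function that is only defined on sufficiently large integers is represented by an arbitrary
  extension to all integers; membership below does not depend on the extension.
\<close>

definition QP_eventually :: "(int \<Rightarrow> int) set" where
  "QP_eventually = {f. \<exists>s>0. \<exists>F :: nat \<Rightarrow> rat poly. \<forall>i<s.
     \<forall>\<^sub>F n in at_top. [n = int i] (mod int s) \<longrightarrow> of_int (f n) = poly (F i) (of_int n)}"

definition eval_mat :: "int poly mat \<Rightarrow> int \<Rightarrow> int mat" where
  "eval_mat A n = map_mat (\<lambda>p. poly p n) A"

definition eval_vec :: "int poly vec \<Rightarrow> int \<Rightarrow> int vec" where
  "eval_vec b n = map_vec (\<lambda>p. poly p n) b"

definition nonneg_solutions :: "int mat \<Rightarrow> int vec \<Rightarrow> int vec set" where
  "nonneg_solutions M c =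
     {x \<in> carrier_vec (dim_col M). (\<forall>j < dim_col M. 0 \<le> x $ j) \<and> M *\<^sub>v x = c}"

end

theory Submission
  imports Defs
begin

text \<open>
  Fourier-Motzkin elimination on the homogenised system shows that for large \<open>n\<close> either some solution
  can be moved along a nonnegative kernel vector, so that there are infinitely many, or all solutions
  have entries below a fixed power \<open>n ^ D\<close>. In the second case write the unknowns in base \<open>n\<close>. An
  equation with polynomial coefficients, read modulo \<open>n\<close>, becomes a linear equation with constant
  coefficients in the digits and a carry that is bounded independently of \<open>n\<close>; the remaining
  equation has smaller degree. Summing over the finitely many carries leaves systems
  \<open>\<Sum> x\<^sub>i a\<^sub>i = b + c n\<close> with \<open>0 \<le> x\<^sub>i < n\<close> and constant \<open>a\<close>, \<open>b\<close>, \<open>c\<close>. With \<open>n\<close> itself as one more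
  unknown, Elliott's reduction (split according to \<open>x\<^sub>i \<ge> x\<^sub>j\<close> or \<open>x\<^sub>i < x\<^sub>j\<close> for two coefficients of
  opposite sign) removes the equations one after another, until only the number of representations
  \<open>n = \<Sum> x\<^sub>i a\<^sub>i\<close> with \<open>a\<^sub>i > 0\<close> is left. It is a quasi-polynomial because its \<open>a\<^sub>i\<close>-step
  difference is the same function with one summand less.
\<close>

section \<open>Quasi-polynomials\<close>

text \<open>The period is a parameter so that several functions can be brought to a common one
  before their polynomials are added. An \<open>i\<close> outside the range of \<open>mod\<close>
  gives an empty class, so no range condition has to be carried along.\<close>

definition quasi_poly_period :: "nat \<Rightarrow> (int \<Rightarrow> int) \<Rightarrow> bool" where
  "quasi_poly_period s f \<longleftrightarrow> s > 0 \<and> (\<forall>i. \<exists>p :: rat poly.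
     \<forall>\<^sub>F n in at_top. n mod int s = i \<longrightarrow> of_int (f n) = poly p (of_int n))"

lemma QP_eventually_iff: "f \<in> QP_eventually \<longleftrightarrow> (\<exists>s. quasi_poly_period s f)"
proof
  assume "f \<in> QP_eventually"
  then obtain s F where s: "s > 0" and F: "\<And>i. i < s \<Longrightarrow>
      \<forall>\<^sub>F n in at_top. [n = int i] (mod int s) \<longrightarrow> of_int (f n) = poly (F i :: rat poly) (of_int n)"
    unfolding QP_eventually_def by blast
  have "\<exists>p :: rat poly. \<forall>\<^sub>F n in at_top. n mod int s = i \<longrightarrow> of_int (f n) = poly p (of_int n)" for i
  proof (cases "0 \<le> i \<and> i < int s")
    case True
    with F[of "nat i"] show ?thesis by (auto simp: cong_def intro!: exI[of _ "F (nat i)"])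
  next
    case False
    have "n mod int s \<noteq> i" for n using False s by force
    then show ?thesis by auto
  qed
  then show "\<exists>s. quasi_poly_period s f" using s unfolding quasi_poly_period_def by blast
next
  assume "\<exists>s. quasi_poly_period s f"
  then obtain s where s: "s > 0" and "\<forall>i. \<exists>p :: rat poly.
     \<forall>\<^sub>F n in at_top. n mod int s = i \<longrightarrow> of_int (f n) = poly p (of_int n)"
    unfolding quasi_poly_period_def by blast
  then obtain P :: "int \<Rightarrow> rat poly"
    where P: "\<And>i. \<forall>\<^sub>F n in at_top. n mod int s = i \<longrightarrow> of_int (f n) = poly (P i) (of_int n)"
    by metis
  have "\<forall>\<^sub>F n in at_top. [n = int i] (mod int s) \<longrightarrow> of_int (f n) = poly (P (int i)) (of_int n)"
    if "i < s" for i using P[of "int i"] that by (simp add: cong_def)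
  then show "f \<in> QP_eventually"
    unfolding QP_eventually_def using s by (auto intro!: exI[of _ s] exI[of _ "\<lambda>i. P (int i)"])
qed

section \<open>Closure under sums and shifts\<close>

text \<open>A residue modulo \<open>k * s\<close> determines the one modulo \<open>s\<close>, so
  each finer class inherits the polynomial of the coarser one.\<close>

lemma quasi_poly_period_mult:
  assumes "quasi_poly_period s f" "k > 0"
  shows "quasi_poly_period (k * s) f"
  unfolding quasi_poly_period_def
proof (intro conjI allI)
  show "k * s > 0" using assms by (simp add: quasi_poly_period_def)
  fix i
  obtain p :: "rat poly" where
    "\<forall>\<^sub>F n in at_top. n mod int s = i mod int s \<longrightarrow> of_int (f n) = poly p (of_int n)"
    using assms(1) unfolding quasi_poly_period_def by blast
  then have "\<forall>\<^sub>F n in at_top. n mod int (k * s) = i \<longrightarrow> of_int (f n) = poly p (of_int n)"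
    by (rule eventually_mono) (auto simp: mod_mod_cancel)
  then show "\<exists>p :: rat poly. \<forall>\<^sub>F n in at_top. n mod int (k * s) = i \<longrightarrow> of_int (f n) = poly p (of_int n)"
    by blast
qed

lemma QP_eventually_cong:
  assumes "g \<in> QP_eventually" "\<forall>\<^sub>F n in at_top. f n = g n"
  shows "f \<in> QP_eventually"
proof -
  obtain s where s: "quasi_poly_period s g" using assms(1) QP_eventually_iff by blast
  have "quasi_poly_period s f" unfolding quasi_poly_period_def
  proof (intro conjI allI)
    show "s > 0" using s by (simp add: quasi_poly_period_def)
    fix i
    obtain p :: "rat poly" where
      "\<forall>\<^sub>F n in at_top. n mod int s = i \<longrightarrow> of_int (g n) = poly p (of_int n)"
      using s unfolding quasi_poly_period_def by blast
    with assms(2) have "\<forall>\<^sub>F n in at_top. n mod int s = i \<longrightarrow> of_int (f n) = poly p (of_int n)"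
      by eventually_elim auto
    then show "\<exists>p :: rat poly. \<forall>\<^sub>F n in at_top. n mod int s = i \<longrightarrow> of_int (f n) = poly p (of_int n)"
      by blast
  qed
  then show ?thesis using QP_eventually_iff by blast
qed

lemma QP_eventually_const: "(\<lambda>_. c) \<in> QP_eventually"
  unfolding QP_eventually_iff quasi_poly_period_def
  by (auto intro!: exI[of _ 1] exI[of _ "[:of_int c:]"])

lemma quasi_poly_period_add:
  assumes "quasi_poly_period s f" "quasi_poly_period s g"
  shows "quasi_poly_period s (\<lambda>n. f n + g n)"
  unfolding quasi_poly_period_def
proof (intro conjI allI)
  show "s > 0" using assms by (simp add: quasi_poly_period_def)
  fix i
  obtain p q :: "rat poly" where
    "\<forall>\<^sub>F n in at_top. n mod int s = i \<longrightarrow> of_int (f n) = poly p (of_int n)"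
    "\<forall>\<^sub>F n in at_top. n mod int s = i \<longrightarrow> of_int (g n) = poly q (of_int n)"
    using assms unfolding quasi_poly_period_def by meson
  then have "\<forall>\<^sub>F n in at_top. n mod int s = i \<longrightarrow> of_int (f n + g n) = poly (p + q) (of_int n)"
    by eventually_elim auto
  then show "\<exists>p :: rat poly. \<forall>\<^sub>F n in at_top. n mod int s = i \<longrightarrow>
      of_int (f n + g n) = poly p (of_int n)"
    by blast
qed

lemma quasi_poly_period_sum:
  assumes "finite I" "I \<noteq> {}" "\<And>i. i \<in> I \<Longrightarrow> quasi_poly_period s (f i)"
  shows "quasi_poly_period s (\<lambda>n. \<Sum>i\<in>I. f i n)"
  using assms by (induction I rule: finite_ne_induct) (simp_all add: quasi_poly_period_add)

lemma QP_eventually_add: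
  assumes "f \<in> QP_eventually" "g \<in> QP_eventually"
  shows "(\<lambda>n. f n + g n) \<in> QP_eventually"
proof -
  obtain s t where "quasi_poly_period s f" "quasi_poly_period t g"
    using assms QP_eventually_iff by blast
  then have f: "quasi_poly_period (t * s) f" and g: "quasi_poly_period (t * s) g"
    using quasi_poly_period_mult[of s f t] quasi_poly_period_mult[of t g s]
    by (auto simp: quasi_poly_period_def mult.commute)
  then show ?thesis using QP_eventually_iff quasi_poly_period_add by blast
qed

lemma QP_eventually_sum:
  "(\<And>i. i \<in> I \<Longrightarrow> f i \<in> QP_eventually) \<Longrightarrow> (\<lambda>n. \<Sum>i\<in>I. f i n) \<in> QP_eventually"
proof (induction I rule: infinite_finite_induct)
  case (insert i I)
  then show ?case using QP_eventually_add[of "f i" "\<lambda>n. \<Sum>i\<in>I. f i n"] by simp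
qed (simp_all add: QP_eventually_const)

lemma eventually_at_top_shift_int:
  assumes "\<forall>\<^sub>F n in at_top. P (n :: int)"
  shows "\<forall>\<^sub>F n in at_top. P (n + c)"
proof -
  obtain N where "\<And>n. n \<ge> N \<Longrightarrow> P n" using assms by (auto simp: eventually_at_top_linorder)
  then show ?thesis by (auto simp: eventually_at_top_linorder intro!: exI[of _ "N - c"])
qed

lemma quasi_poly_period_shift:
  assumes "quasi_poly_period s f"
  shows "quasi_poly_period s (\<lambda>n. f (n + c))"
  unfolding quasi_poly_period_def
proof (intro conjI allI)
  show "s > 0" using assms by (simp add: quasi_poly_period_def)
  fix i
  \<comment> \<open>If \<open>n\<close> lies in class \<open>i\<close>, then \<open>n + c\<close>
    lies in the class of \<open>i + c\<close>; substituting \<open>n + c\<close> into the polynomial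
    of that class gives the one for the shifted function.\<close>
  obtain p :: "rat poly" where
    "\<forall>\<^sub>F n in at_top. n mod int s = (i + c) mod int s \<longrightarrow> of_int (f n) = poly p (of_int n)"
    using assms unfolding quasi_poly_period_def by blast
  then have "\<forall>\<^sub>F n in at_top. (n + c) mod int s = (i + c) mod int s \<longrightarrow>
      of_int (f (n + c)) = poly p (of_int (n + c))"
    by (rule eventually_at_top_shift_int)
  then have "\<forall>\<^sub>F n in at_top. n mod int s = i \<longrightarrow>
      of_int (f (n + c)) = poly (pcompose p [:of_int c, 1:]) (of_int n)"
    by (rule eventually_mono) (auto simp: poly_pcompose mod_simps add.commute)
  then show "\<exists>p :: rat poly. \<forall>\<^sub>F n in at_top. n mod int s = i \<longrightarrow>
      of_int (f (n + c)) = poly p (of_int n)"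
    by blast
qed

lemma QP_eventually_shift: "f \<in> QP_eventually \<Longrightarrow> (\<lambda>n. f (n + c)) \<in> QP_eventually"
  using quasi_poly_period_shift unfolding QP_eventually_iff by blast

section \<open>Discrete antiderivatives\<close>

text \<open>The backward difference of \<open>x ^ Suc k\<close> with step \<open>d\<close> is
  \<open>of_nat (Suc k) * d * x ^ k\<close> plus lower powers, and these have antidifferences by
  strong induction.\<close>

lemma monomial_antidifference:
  fixes d :: "'a :: field_char_0"
  assumes "d \<noteq> 0"
  shows "\<exists>P. \<forall>x. poly P x - poly P (x - d) = x ^ k"
proof (induction k rule: less_induct)
  case (less k)
  then obtain P where P: "\<And>j x. j < k \<Longrightarrow> poly (P j) x - poly (P j) (x - d) = x ^ j"
    by metis
  \<comment> \<open>These are the coefficients of \<open>(x - d) ^ Suc k\<close>. Adding the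
    antidifferences of the terms with \<open>j < k\<close> cancels everything below
    \<open>x ^ k\<close> in the difference of \<open>x ^ Suc k\<close>.\<close>
  define c where "c j = of_nat (Suc k choose j) * (- d) ^ (Suc k - j)" for j
  define Q where "Q = smult (1 / (of_nat (Suc k) * d)) (monom 1 (Suc k) + (\<Sum>j<k. smult (c j) (P j)))"
  have "poly Q x - poly Q (x - d) = x ^ k" for x
  proof -
    have "(x - d) ^ Suc k = (\<Sum>j\<le>Suc k. c j * x ^ j)"
      using binomial_ring[of x "- d" "Suc k"] by (simp add: c_def mult_ac)
    also have "\<dots> = (\<Sum>j<k. c j * x ^ j) + c k * x ^ k + c (Suc k) * x ^ Suc k"
      by (simp add: lessThan_Suc_atMost[symmetric])
    finally have eq: "x ^ Suc k - (x - d) ^ Suc k + (\<Sum>j<k. c j * x ^ j) = of_nat (Suc k) * d * x ^ k"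
      by (simp add: c_def algebra_simps)
    have "(\<Sum>j<k. c j * poly (P j) x) - (\<Sum>j<k. c j * poly (P j) (x - d)) = (\<Sum>j<k. c j * x ^ j)"
      unfolding sum_subtractf[symmetric] right_diff_distrib[symmetric] by (simp add: P)
    then have "poly Q x - poly Q (x - d) = 1 / (of_nat (Suc k) * d) *
        (x ^ Suc k - (x - d) ^ Suc k + (\<Sum>j<k. c j * x ^ j))"
      by (simp add: Q_def poly_monom poly_sum diff_divide_distrib[symmetric] del: power_Suc of_nat_Suc)
    also have "\<dots> = x ^ k"
      unfolding eq using assms by (simp del: of_nat_Suc)
    finally show ?thesis .
  qed
  then show ?case by blast
qed

lemma poly_antidifference:
  fixes p :: "'a :: field_char_0 poly"
  assumes "d \<noteq> 0"
  shows "\<exists>P. \<forall>x. poly P x - poly P (x - d) = poly p x"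
proof -
  obtain P where P: "\<And>k x. poly (P k) x - poly (P k) (x - d) = x ^ k"
    using monomial_antidifference[OF assms] by metis
  show ?thesis
  proof (intro exI allI)
    fix x
    show "poly (\<Sum>k\<le>degree p. smult (coeff p k) (P k)) x
        - poly (\<Sum>k\<le>degree p. smult (coeff p k) (P k)) (x - d) = poly p x"
      unfolding poly_altdef[of p]
      by (simp add: poly_sum sum_subtractf[symmetric] right_diff_distrib[symmetric] P)
  qed
qed

text \<open>Adding up \<open>s\<close> consecutive differences of step \<open>a\<close> gives the
  difference of step \<open>S = a * s\<close>, which for large \<open>n\<close> is a polynomial on
  each class modulo \<open>S\<close>. On such a class \<open>g\<close> eventually differs from a
  polynomial antidifference by a constant.\<close>

lemma QP_eventually_antidifference:
  assumes h: "h \<in> QP_eventually" and a: "a > 0"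
    and g: "\<And>n. g n - g (n - a) = h n"
  shows "g \<in> QP_eventually"
proof -
  obtain s where s: "quasi_poly_period s h" using h QP_eventually_iff by blast
  have s0: "s > 0" using s by (simp add: quasi_poly_period_def)
  \<comment> \<open>A multiple of \<open>a\<close>, so that the given differences telescope to step
    \<open>S\<close>, and of \<open>s\<close>, so that the shifted copies of \<open>h\<close> are
    polynomial on classes modulo \<open>S\<close>.\<close>
  define S where "S = nat a * s"
  have S: "int S = a * int s" "S > 0" using a s0 by (simp_all add: S_def)
  have "quasi_poly_period s (\<lambda>n. \<Sum>r<s. h (n - a * int r))"
    using quasi_poly_period_shift[OF s, of "- a * int _"] s0
    by (intro quasi_poly_period_sum) auto
  then have per: "quasi_poly_period S (\<lambda>n. \<Sum>r<s. h (n - a * int r))"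
    unfolding S_def by (rule quasi_poly_period_mult) (use a in simp)
  \<comment> \<open>The summation index shadows the outer \<open>r\<close>, which on the right-hand
    side survives only as the upper limit.\<close>
  have "g n - g (n - a * int r) = (\<Sum>r<r. h (n - a * int r))" for n r
  proof (induction r)
    case (Suc r)
    show ?case using Suc.IH g[of "n - a * int r"] by (simp add: algebra_simps)
  qed simp
  then have tele: "g n - g (n - int S) = (\<Sum>r<s. h (n - a * int r))" for n
    using S(1) by simp
  have "quasi_poly_period S g" unfolding quasi_poly_period_def
  proof (intro conjI allI)
    fix i
    obtain p :: "rat poly" and N where p: "\<And>n. n \<ge> N \<Longrightarrow> n mod int S = i \<Longrightarrow>
        of_int (\<Sum>r<s. h (n - a * int r)) = poly p (of_int n)"
      using per unfolding quasi_poly_period_def eventually_at_top_linorder by meson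
    obtain P where P: "\<And>x. poly P x - poly P (x - of_int (int S)) = poly p x"
      using poly_antidifference[of "of_int (int S)" p] S(2) by auto
    \<comment> \<open>The first integer from \<open>N\<close> on that is congruent to
      \<open>i\<close>; it anchors the constant \<open>C\<close>.\<close>
    define N0 where "N0 = N + (i - N) mod int S"
    define C where "C = of_int (g N0) - poly P (of_int N0)"
    have N0: "N0 mod int S = i mod int S" "N0 \<ge> N"
      using S(2) by (simp_all add: N0_def mod_simps)
    have step: "of_int (g (N0 + int S * int q)) - poly P (of_int (N0 + int S * int q)) = C"
      if i: "i mod int S = i" for q
    proof (induction q)
      case (Suc q)
      define n where "n = N0 + int S * int (Suc q)"
      have "n mod int S = i" "n \<ge> N" using N0 i by (simp_all add: n_def add_increasing2)
      then have "rat_of_int (g n - g (n - int S)) = poly P (of_int n) - poly P (of_int (n - int S))"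
        using p[of n] P[of "of_int n"] by (simp add: tele)
      moreover have "n - int S = N0 + int S * int q" by (simp add: n_def algebra_simps)
      ultimately show ?case using Suc.IH unfolding n_def[symmetric] by simp
    qed (simp add: C_def)
    have "of_int (g n) = poly (P + [:C:]) (of_int n)" if n: "n \<ge> N0" "n mod int S = i" for n
    proof -
      have i: "i mod int S = i" using n(2) by auto
      have "int S dvd n - N0" using n(2) N0(1) i by (metis mod_eq_dvd_iff)
      then obtain q where q: "n - N0 = int S * q" by blast
      have "q \<ge> 0" using q n(1) S(2) by (metis diff_ge_0_iff_ge of_nat_0_less_iff zero_le_mult_iff not_le)
      then have "n = N0 + int S * int (nat q)" using q by simp
      then show ?thesis using step[OF i, of "nat q"] by (simp add: algebra_simps)
    qed
    then show "\<exists>p :: rat poly. \<forall>\<^sub>F n in at_top. n mod int S = i \<longrightarrow> of_int (g n) = poly p (of_int n)"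
      unfolding eventually_at_top_linorder by blast
  qed (use S in simp)
  then show ?thesis using QP_eventually_iff by blast
qed

section \<open>Elliott reduction\<close>

text \<open>\<open>V i\<close> is the column of the unknown \<open>i\<close>, and \<open>w\<close>
  the right-hand side. Vanishing off \<open>I\<close> makes a solution determined by its values on
  \<open>I\<close>, so that \<open>card\<close> counts the intended vectors.\<close>

definition lin_sols :: "'a set \<Rightarrow> 'c set \<Rightarrow> ('a \<Rightarrow> 'c \<Rightarrow> int) \<Rightarrow> ('c \<Rightarrow> int) \<Rightarrow> ('a \<Rightarrow> nat) set" where
  "lin_sols I T V w = {x. (\<forall>i. i \<notin> I \<longrightarrow> x i = 0) \<and> (\<forall>t\<in>T. (\<Sum>i\<in>I. int (x i) * V i t) = w t)}"

lemma sum_two_terms: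
  fixes f :: "'a \<Rightarrow> 'b :: comm_monoid_add"
  assumes "finite I" "i \<in> I" "j \<in> I" "i \<noteq> j"
  shows "sum f I = f i + f j + sum f (I - {i, j})"
proof -
  have "I = insert i (insert j (I - {i, j}))" using assms by auto
  then have "sum f I = sum f (insert i (insert j (I - {i, j})))" by simp
  also have "\<dots> = f i + f j + sum f (I - {i, j})" using assms by (simp add: add.assoc)
  finally show ?thesis .
qed

text \<open>With the excess \<open>x i - x j\<close> as new unknown, the inequality becomes
  nonnegativity of that unknown, and the column of \<open>x j\<close> absorbs the column of
  \<open>x i\<close>.\<close>

lemma lin_sols_ge:
  assumes I: "finite I" "i \<in> I" "j \<in> I" "i \<noteq> j"
  shows "bij_betw (\<lambda>x. x(i := x i + x j)) (lin_sols I T (V(j := \<lambda>t. V j t + V i t)) w)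
    {x \<in> lin_sols I T V w. x i \<ge> x j}"
proof (rule bij_betw_byWitness[where f' = "\<lambda>x. x(i := x i - x j)"])
  have eq: "(\<Sum>l\<in>I. int ((x(i := x i + x j)) l) * V l t)
      = (\<Sum>l\<in>I. int (x l) * (V(j := \<lambda>t. V j t + V i t)) l t)" for x t
    using I by (simp add: sum_two_terms algebra_simps)
  show "(\<lambda>x. x(i := x i + x j)) ` lin_sols I T (V(j := \<lambda>t. V j t + V i t)) w
      \<subseteq> {x \<in> lin_sols I T V w. x i \<ge> x j}"
  proof (intro subsetI, elim imageE)
    fix x y assume y: "y \<in> lin_sols I T (V(j := \<lambda>t. V j t + V i t)) w" "x = y(i := y i + y j)"
    then show "x \<in> {x \<in> lin_sols I T V w. x i \<ge> x j}"
      using eq[of y] I unfolding lin_sols_def by simp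
  qed
  show "(\<lambda>x. x(i := x i - x j)) ` {x \<in> lin_sols I T V w. x i \<ge> x j}
      \<subseteq> lin_sols I T (V(j := \<lambda>t. V j t + V i t)) w"
  proof (intro subsetI, elim imageE)
    fix x y assume y: "y \<in> {x \<in> lin_sols I T V w. x i \<ge> x j}" "x = y(i := y i - y j)"
    have xy: "x(i := x i + x j) = y" using y I by auto
    have "(\<Sum>l\<in>I. int (x l) * (V(j := \<lambda>t. V j t + V i t)) l t) = w t" if "t \<in> T" for t
      using y(1) eq[of x t] that unfolding xy lin_sols_def by simp
    moreover have "\<forall>l. l \<notin> I \<longrightarrow> x l = 0" using y I unfolding lin_sols_def by simp
    ultimately show "x \<in> lin_sols I T (V(j := \<lambda>t. V j t + V i t)) w"
      unfolding lin_sols_def by simp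
  qed
qed (use I in auto)

text \<open>The inequality is strict, so the new unknown is \<open>x j - x i - 1\<close>; the extra
  1 contributes one copy of column \<open>V j\<close>, which moves to the right-hand side.\<close>

lemma lin_sols_less:
  assumes I: "finite I" "i \<in> I" "j \<in> I" "i \<noteq> j"
  shows "bij_betw (\<lambda>x. x(j := x j + x i + 1))
    (lin_sols I T (V(i := \<lambda>t. V i t + V j t)) (\<lambda>t. w t - V j t))
    {x \<in> lin_sols I T V w. x i < x j}"
proof (rule bij_betw_byWitness[where f' = "\<lambda>x. x(j := x j - x i - 1)"])
  have eq: "(\<Sum>l\<in>I. int ((x(j := x j + x i + 1)) l) * V l t)
      = (\<Sum>l\<in>I. int (x l) * (V(i := \<lambda>t. V i t + V j t)) l t) + V j t" for x t
    using I by (simp add: sum_two_terms algebra_simps)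
  show "(\<lambda>x. x(j := x j + x i + 1)) ` lin_sols I T (V(i := \<lambda>t. V i t + V j t)) (\<lambda>t. w t - V j t)
      \<subseteq> {x \<in> lin_sols I T V w. x i < x j}"
  proof (intro subsetI, elim imageE)
    fix x y assume y: "y \<in> lin_sols I T (V(i := \<lambda>t. V i t + V j t)) (\<lambda>t. w t - V j t)"
      "x = y(j := y j + y i + 1)"
    then show "x \<in> {x \<in> lin_sols I T V w. x i < x j}"
      using eq[of y] I unfolding lin_sols_def by simp
  qed
  show "(\<lambda>x. x(j := x j - x i - 1)) ` {x \<in> lin_sols I T V w. x i < x j}
      \<subseteq> lin_sols I T (V(i := \<lambda>t. V i t + V j t)) (\<lambda>t. w t - V j t)"
  proof (intro subsetI, elim imageE)
    fix x y assume y: "y \<in> {x \<in> lin_sols I T V w. x i < x j}" "x = y(j := y j - y i - 1)"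
    have xy: "x(j := x j + x i + 1) = y" using y I by auto
    have "(\<Sum>l\<in>I. int (x l) * (V(i := \<lambda>t. V i t + V j t)) l t) = w t - V j t" if "t \<in> T" for t
      using y(1) eq[of x t] that unfolding xy lin_sols_def by simp
    moreover have "\<forall>l. l \<notin> I \<longrightarrow> x l = 0" using y I unfolding lin_sols_def by simp
    ultimately show "x \<in> lin_sols I T (V(i := \<lambda>t. V i t + V j t)) (\<lambda>t. w t - V j t)"
      unfolding lin_sols_def by simp
  qed
qed (use I in auto)

lemma card_lin_sols_split:
  assumes I: "finite I" "i \<in> I" "j \<in> I" "i \<noteq> j" and fin: "finite (lin_sols I T V w)"
  shows "finite (lin_sols I T (V(j := \<lambda>t. V j t + V i t)) w)"
    and "finite (lin_sols I T (V(i := \<lambda>t. V i t + V j t)) (\<lambda>t. w t - V j t))"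
    and "card (lin_sols I T V w) = card (lin_sols I T (V(j := \<lambda>t. V j t + V i t)) w)
      + card (lin_sols I T (V(i := \<lambda>t. V i t + V j t)) (\<lambda>t. w t - V j t))"
proof -
  note b = lin_sols_ge[OF I, of T V w] lin_sols_less[OF I, of T V w]
  show "finite (lin_sols I T (V(j := \<lambda>t. V j t + V i t)) w)"
    "finite (lin_sols I T (V(i := \<lambda>t. V i t + V j t)) (\<lambda>t. w t - V j t))"
    using b fin by (simp_all add: bij_betw_finite)
  have "lin_sols I T V w = {x \<in> lin_sols I T V w. x i \<ge> x j} \<union> {x \<in> lin_sols I T V w. x i < x j}"
    by auto
  then have "card (lin_sols I T V w)
      = card ({x \<in> lin_sols I T V w. x i \<ge> x j} \<union> {x \<in> lin_sols I T V w. x i < x j})"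
    by simp
  also have "\<dots> = card {x \<in> lin_sols I T V w. x i \<ge> x j} + card {x \<in> lin_sols I T V w. x i < x j}"
    using fin by (intro card_Un_disjoint) auto
  finally show "card (lin_sols I T V w) = card (lin_sols I T (V(j := \<lambda>t. V j t + V i t)) w)
      + card (lin_sols I T (V(i := \<lambda>t. V i t + V j t)) (\<lambda>t. w t - V j t))"
    using bij_betw_same_card[OF b(1)] bij_betw_same_card[OF b(2)] by simp
qed

lemma lin_sols_fix_variable:
  assumes I: "finite I" "i \<in> I"
  shows "bij_betw (\<lambda>x. x(i := r)) (lin_sols (I - {i}) T V (\<lambda>t. w t - int r * V i t))
    {x \<in> lin_sols I T V w. x i = r}"
proof (rule bij_betw_byWitness[where f' = "\<lambda>x. x(i := 0)"])
  have eq: "(\<Sum>l\<in>I. int ((x(i := z)) l) * V l t) = int z * V i t + (\<Sum>l\<in>I - {i}. int (x l) * V l t)" for x z t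
  proof -
    have "(\<Sum>l\<in>I - {i}. int ((x(i := z)) l) * V l t) = (\<Sum>l\<in>I - {i}. int (x l) * V l t)"
      by (rule sum.cong) auto
    then show ?thesis using I by (simp add: sum.remove)
  qed
  show "(\<lambda>x. x(i := r)) ` lin_sols (I - {i}) T V (\<lambda>t. w t - int r * V i t)
      \<subseteq> {x \<in> lin_sols I T V w. x i = r}"
  proof (intro subsetI, elim imageE)
    fix x y assume y: "y \<in> lin_sols (I - {i}) T V (\<lambda>t. w t - int r * V i t)" "x = y(i := r)"
    have "(\<Sum>l\<in>I. int (x l) * V l t) = w t" if "t \<in> T" for t
      using y(1) that unfolding y(2) eq lin_sols_def by simp
    then show "x \<in> {x \<in> lin_sols I T V w. x i = r}"
      using y I unfolding lin_sols_def by auto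
  qed
  show "(\<lambda>x. x(i := 0)) ` {x \<in> lin_sols I T V w. x i = r}
      \<subseteq> lin_sols (I - {i}) T V (\<lambda>t. w t - int r * V i t)"
  proof (intro subsetI, elim imageE)
    fix x y assume y: "y \<in> {x \<in> lin_sols I T V w. x i = r}" "x = y(i := 0)"
    have yx: "y = x(i := r)" using y by auto
    have "(\<Sum>l\<in>I - {i}. int (x l) * V l t) = w t - int r * V i t" if "t \<in> T" for t
      using y(1) that eq[of x r t] unfolding yx lin_sols_def by simp
    then show "x \<in> lin_sols (I - {i}) T V (\<lambda>t. w t - int r * V i t)"
      using y I unfolding lin_sols_def by auto
  qed
qed (auto simp: lin_sols_def)

lemma card_lin_sols_fix_variable:
  assumes I: "finite I" "i \<in> I" and fin: "finite (lin_sols I T V w)"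
    and bound: "\<forall>x\<in>lin_sols I T V w. x i \<le> B"
  shows "finite (lin_sols (I - {i}) T V (\<lambda>t. w t - int r * V i t))"
    and "card (lin_sols I T V w) = (\<Sum>r\<le>B. card (lin_sols (I - {i}) T V (\<lambda>t. w t - int r * V i t)))"
proof -
  note b = lin_sols_fix_variable[OF I, of _ T V w]
  show "finite (lin_sols (I - {i}) T V (\<lambda>t. w t - int r * V i t))"
    using b[of r] fin by (simp add: bij_betw_finite)
  have "lin_sols I T V w = (\<Union>r\<le>B. {x \<in> lin_sols I T V w. x i = r})"
    using bound by auto
  then have "card (lin_sols I T V w) = card (\<Union>r\<le>B. {x \<in> lin_sols I T V w. x i = r})"
    by simp
  also have "\<dots> = (\<Sum>r\<le>B. card {x \<in> lin_sols I T V w. x i = r})"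
    using fin by (intro card_UN_disjoint) auto
  also have "\<dots> = (\<Sum>r\<le>B. card (lin_sols (I - {i}) T V (\<lambda>t. w t - int r * V i t)))"
    using bij_betw_same_card[OF b] by simp
  finally show "card (lin_sols I T V w) = (\<Sum>r\<le>B. card (lin_sols (I - {i}) T V (\<lambda>t. w t - int r * V i t)))" .
qed

section \<open>Representations of \<open>n\<close> with positive coefficients\<close>

lemma finite_bounded_functions:
  assumes "finite I" "X \<subseteq> {x. (\<forall>i. i \<notin> I \<longrightarrow> x i = 0) \<and> (\<forall>i\<in>I. x i \<le> (B :: nat))}"
  shows "finite X"
proof (rule finite_subset)
  show "finite {x. \<forall>i. (i \<in> I \<longrightarrow> x i \<in> {..B}) \<and> (i \<notin> I \<longrightarrow> x i = 0)}"
    by (rule finite_set_of_finite_funs) (use assms in auto)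
qed (use assms in auto)

text \<open>Representations with \<open>x i > 0\<close> correspond to representations of
  \<open>n - a i\<close> by lowering \<open>x i\<close>; those with \<open>x i = 0\<close> use only
  \<open>I\<close>. Hence the \<open>a i\<close>-step difference of the count is the count for one
  summand less.\<close>

lemma QP_eventually_card_denumerant:
  assumes "finite I" "\<And>i. i \<in> I \<Longrightarrow> a i > 0"
  shows "(\<lambda>n. int (card {x. (\<forall>i. i \<notin> I \<longrightarrow> x i = 0) \<and> (\<Sum>i\<in>I. int (x i) * a i) = n})) \<in> QP_eventually"
  using assms
proof (induction I rule: finite_induct)
  case empty
  \<comment> \<open>The empty sum represents only 0, so the count vanishes for positive
    \<open>n\<close>.\<close>
  have "\<forall>\<^sub>F n in at_top. int (card {x. (\<forall>i :: 'a. x i = 0) \<and> (0 :: int) = n}) = 0"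
    using eventually_gt_at_top[of 0] by eventually_elim auto
  then show ?case by (intro QP_eventually_cong[OF QP_eventually_const[of 0]]) simp
next
  case (insert i I)
  define S where "S J n = {x. (\<forall>i. i \<notin> J \<longrightarrow> x i = 0) \<and> (\<Sum>i\<in>J. int (x i) * a i) = n}" for J n
  define g where "g n = int (card (S (insert i I) n))" for n
  define h where "h n = int (card (S I n))" for n
  have h: "h \<in> QP_eventually" using insert.IH insert.prems unfolding h_def S_def by simp
  \<comment> \<open>Positive coefficients bound every unknown by \<open>n\<close>. Finiteness makes
    \<open>card\<close> additive over the two cases below.\<close>
  have fin: "finite (S (insert i I) n)" for n
  proof (rule finite_bounded_functions[of "insert i I" _ "nat n"])
    show "S (insert i I) n \<subseteq> {x. (\<forall>j. j \<notin> insert i I \<longrightarrow> x j = 0) \<and> (\<forall>j\<in>insert i I. x j \<le> nat n)}"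
    proof (intro subsetI CollectI conjI ballI)
      fix x j assume x: "x \<in> S (insert i I) n" and j: "j \<in> insert i I"
      have "int (x j) * 1 \<le> int (x j) * a j" using insert.prems[OF j] by (intro mult_left_mono) auto
      also have "\<dots> \<le> (\<Sum>j\<in>insert i I. int (x j) * a j)"
        using insert.hyps insert.prems j
        by (intro member_le_sum) (auto intro!: mult_nonneg_nonneg simp: less_imp_le)
      finally show "x j \<le> nat n" using x unfolding S_def by simp
    qed (auto simp: S_def)
  qed (use insert.hyps in simp)
  have "g n - g (n - a i) = h n" for n
  proof -
    have sum: "(\<Sum>j\<in>I. int ((x(i := z)) j) * a j) = (\<Sum>j\<in>I. int (x j) * a j)" for x z
      using insert.hyps by (intro sum.cong) auto
    have "S (insert i I) n = S I n \<union> (\<lambda>x. x(i := Suc (x i))) ` S (insert i I) (n - a i)"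
    proof (intro equalityI subsetI)
      fix x assume x: "x \<in> S (insert i I) n"
      show "x \<in> S I n \<union> (\<lambda>x. x(i := Suc (x i))) ` S (insert i I) (n - a i)"
      proof (cases "x i = 0")
        case True
        then have "\<forall>j. j \<notin> I \<longrightarrow> x j = 0" using x unfolding S_def by (metis (mono_tags, lifting) insertE mem_Collect_eq)
        then have "x \<in> S I n" using x True insert.hyps unfolding S_def by simp
        then show ?thesis by simp
      next
        case False
        then have "x = (x(i := x i - 1))(i := Suc ((x(i := x i - 1)) i))" by auto
        moreover have "x(i := x i - 1) \<in> S (insert i I) (n - a i)"
          using x False insert.hyps sum[of x "x i - 1"] unfolding S_def
          by (auto simp: of_nat_diff algebra_simps)
        ultimately show ?thesis by blast
      qed
    next
      fix x assume "x \<in> S I n \<union> (\<lambda>x. x(i := Suc (x i))) ` S (insert i I) (n - a i)"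
      then show "x \<in> S (insert i I) n"
      proof
        assume "x \<in> S I n"
        then show ?thesis using insert.hyps unfolding S_def by auto
      next
        assume "x \<in> (\<lambda>x. x(i := Suc (x i))) ` S (insert i I) (n - a i)"
        then obtain y where "x = y(i := Suc (y i))" "y \<in> S (insert i I) (n - a i)" by blast
        then show ?thesis using insert.hyps sum[of y "Suc (y i)"] unfolding S_def
          by (auto simp: algebra_simps simp del: fun_upd_apply) (auto simp: algebra_simps)
      qed
    qed
    moreover have "S I n \<inter> (\<lambda>x. x(i := Suc (x i))) ` S (insert i I) (n - a i) = {}"
      using insert.hyps unfolding S_def by auto
    moreover have "inj_on (\<lambda>x. x(i := Suc (x i))) (S (insert i I) (n - a i))"
    proof (rule inj_onI)
      fix x y :: "'a \<Rightarrow> nat" assume "x(i := Suc (x i)) = y(i := Suc (y i))"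
      then show "x = y" by (auto simp: fun_eq_iff split: if_splits)
    qed
    moreover have "finite (S I n)" "finite ((\<lambda>x. x(i := Suc (x i))) ` S (insert i I) (n - a i))"
      using fin[of n] calculation(1) by simp_all
    ultimately have "card (S (insert i I) n) = card (S I n) + card (S (insert i I) (n - a i))"
      by (simp add: card_Un_disjoint card_image)
    then show ?thesis by (simp add: g_def h_def)
  qed
  then have "g \<in> QP_eventually"
    using QP_eventually_antidifference[OF h, of "a i" g] insert.prems by simp
  then show ?case unfolding g_def S_def by simp
qed

section \<open>Elimination of the equations one after another\<close>

text \<open>Only the distinguished equation \<open>t0\<close> depends on the parameter
  \<open>n\<close>. The offset \<open>w\<close> is kept separate so that subtracting a column, as in
  \<open>lin_sols_less\<close>, stays within the same family.\<close>

definition shift_at :: "'c \<Rightarrow> ('c \<Rightarrow> int) \<Rightarrow> int \<Rightarrow> 'c \<Rightarrow> int" where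
  "shift_at t0 w n = w(t0 := w t0 + n)"

lemma shift_at_diff: "(\<lambda>t. shift_at t0 w n t - v t) = shift_at t0 (\<lambda>t. w t - v t) n"
  by (auto simp: shift_at_def)

definition lin_count ::
  "'c \<Rightarrow> 'c set \<Rightarrow> 'a set \<Rightarrow> ('a \<Rightarrow> 'c \<Rightarrow> int) \<Rightarrow> ('c \<Rightarrow> int) \<Rightarrow> int \<Rightarrow> int" where
  "lin_count t0 T I V w n = int (card (lin_sols I (insert t0 T) V (shift_at t0 w n)))"

text \<open>
  Nonnegativity in the coordinate \<open>t0\<close>, whose target is \<open>n\<close>, survives the additions of Elliott's
  reduction.
\<close>

definition admissible ::
  "'c \<Rightarrow> 'c set \<Rightarrow> 'a set \<Rightarrow> ('a \<Rightarrow> 'c \<Rightarrow> int) \<Rightarrow> ('c \<Rightarrow> int) \<Rightarrow> bool" where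
  "admissible t0 T I V w \<longleftrightarrow> finite I \<and> (\<forall>i\<in>I. V i t0 \<ge> 0) \<and>
     (\<forall>n. finite (lin_sols I (insert t0 T) V (shift_at t0 w n)))"

lemma admissible_split:
  assumes adm: "admissible t0 T I V w" and ij: "i \<in> I" "j \<in> I" "i \<noteq> j"
  defines "V1 \<equiv> V(j := \<lambda>t. V j t + V i t)" and "V2 \<equiv> V(i := \<lambda>t. V i t + V j t)"
    and "w2 \<equiv> \<lambda>t. w t - V j t"
  shows "admissible t0 T I V1 w" and "admissible t0 T I V2 w2"
    and "lin_count t0 T I V1 w \<in> QP_eventually \<Longrightarrow> lin_count t0 T I V2 w2 \<in> QP_eventually \<Longrightarrow>
      lin_count t0 T I V w \<in> QP_eventually"
proof -
  have I: "finite I" and fin: "\<And>n. finite (lin_sols I (insert t0 T) V (shift_at t0 w n))"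
    using adm unfolding admissible_def by auto
  note split = card_lin_sols_split[OF I ij fin, unfolded shift_at_diff, folded V1_def V2_def w2_def]
  show "admissible t0 T I V1 w" "admissible t0 T I V2 w2"
    using adm ij split(1,2) unfolding admissible_def V1_def V2_def by auto
  have "lin_count t0 T I V w = (\<lambda>n. lin_count t0 T I V1 w n + lin_count t0 T I V2 w2 n)"
    unfolding lin_count_def by (rule ext) (simp add: split(3))
  then show "lin_count t0 T I V w \<in> QP_eventually"
    if "lin_count t0 T I V1 w \<in> QP_eventually" "lin_count t0 T I V2 w2 \<in> QP_eventually"
    using QP_eventually_add[OF that] by simp
qed

text \<open>Terms of one sign cannot cancel, so an unknown with nonzero coefficient in equation
  \<open>t\<close> takes finitely many values. Summing over these values removes the unknown; the
  induction ends when all coefficients in \<open>t\<close> vanish, which is the case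
  \<open>zero\<close>.\<close>

lemma QP_eventually_lin_count_one_signed:
  fixes I :: "'a set"
  assumes zero: "\<And>(I :: 'a set) V w. admissible t0 T I V w \<Longrightarrow> \<forall>i\<in>I. V i t = 0 \<Longrightarrow> lin_count t0 T I V w \<in> QP_eventually"
    and t: "t \<in> T" "t \<noteq> t0"
    and "admissible t0 T I V w" "(\<forall>i\<in>I. V i t \<ge> 0) \<or> (\<forall>i\<in>I. V i t \<le> 0)"
  shows "lin_count t0 T I V w \<in> QP_eventually"
  using assms(4,5)
proof (induction "card I" arbitrary: I w rule: less_induct)
  case less
  show ?case
  proof (cases "\<forall>i\<in>I. V i t = 0")
    case True
    then show ?thesis using zero less.prems by blast
  next
    case False
    then obtain i where i: "i \<in> I" "V i t \<noteq> 0" by blast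
    have I: "finite I" and fin: "\<And>n. finite (lin_sols I (insert t0 T) V (shift_at t0 w n))"
      using less.prems unfolding admissible_def by auto
    \<comment> \<open>Uniform in \<open>n\<close>, because the parameter enters only equation
      \<open>t0\<close> and \<open>t\<close> is another one.\<close>
    define B where "B = nat \<bar>w t\<bar>"
    have bound: "\<forall>x\<in>lin_sols I (insert t0 T) V (shift_at t0 w n). x i \<le> B" for n
    proof
      fix x assume x: "x \<in> lin_sols I (insert t0 T) V (shift_at t0 w n)"
      have "int (x i) * 1 \<le> int (x i) * \<bar>V i t\<bar>" using i by (intro mult_left_mono) auto
      also have "\<dots> \<le> (\<Sum>l\<in>I. int (x l) * \<bar>V l t\<bar>)"
        using I i by (intro member_le_sum) auto
      also have "\<dots> = \<bar>\<Sum>l\<in>I. int (x l) * V l t\<bar>"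
        using less.prems(2)
      proof
        assume pos: "\<forall>i\<in>I. V i t \<ge> 0"
        then have "(\<Sum>l\<in>I. int (x l) * V l t) \<ge> 0" by (intro sum_nonneg) simp
        moreover have "(\<Sum>l\<in>I. int (x l) * \<bar>V l t\<bar>) = (\<Sum>l\<in>I. int (x l) * V l t)"
          using pos by (intro sum.cong) auto
        ultimately show ?thesis by simp
      next
        assume neg: "\<forall>i\<in>I. V i t \<le> 0"
        then have "(\<Sum>l\<in>I. int (x l) * V l t) \<le> 0" by (intro sum_nonpos) (simp add: mult_nonneg_nonpos)
        moreover have "(\<Sum>l\<in>I. int (x l) * \<bar>V l t\<bar>) = (\<Sum>l\<in>I. - (int (x l) * V l t))"
          using neg by (intro sum.cong) auto
        ultimately show ?thesis by (simp add: sum_negf)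
      qed
      also have "\<dots> = \<bar>w t\<bar>" using x t unfolding lin_sols_def shift_at_def by simp
      finally show "x i \<le> B" by (simp add: B_def)
    qed
    note fix_i = card_lin_sols_fix_variable[OF I i(1) fin bound, unfolded shift_at_diff]
    have "lin_count t0 T (I - {i}) V (\<lambda>t. w t - int r * V i t) \<in> QP_eventually" for r
    proof (rule less.hyps)
      show "card (I - {i}) < card I" using I i by (intro card_Diff1_less)
      show "admissible t0 T (I - {i}) V (\<lambda>t. w t - int r * V i t)"
        using less.prems(1) fix_i(1) unfolding admissible_def by simp
    qed (use less.prems in auto)
    then have "(\<lambda>n. \<Sum>r\<le>B. lin_count t0 T (I - {i}) V (\<lambda>t. w t - int r * V i t) n) \<in> QP_eventually"
      by (intro QP_eventually_sum)
    moreover have "lin_count t0 T I V w =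
        (\<lambda>n. \<Sum>r\<le>B. lin_count t0 T (I - {i}) V (\<lambda>t. w t - int r * V i t) n)"
      unfolding lin_count_def by (rule ext) (simp add: fix_i(2))
    ultimately show ?thesis by simp
  qed
qed

text \<open>Two nested inductions make Elliott's splitting terminate: the outer one on the length
  \<open>N + N'\<close> of an interval containing the coefficients of equation \<open>t\<close>, the
  inner one on the number of coefficients in \<open>X\<close>. When no split applies, either the
  signs agree or an endpoint of the interval is not attained.\<close>

lemma QP_eventually_lin_count_eliminate:
  fixes I :: "'a set"
  assumes zero: "\<And>(I :: 'a set) V w. admissible t0 T I V w \<Longrightarrow> \<forall>i\<in>I. V i t = 0 \<Longrightarrow> lin_count t0 T I V w \<in> QP_eventually"
    and t: "t \<in> T" "t \<noteq> t0"
    and adm: "admissible t0 T I V w"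
  shows "lin_count t0 T I V w \<in> QP_eventually"
proof -
  have "lin_count t0 T I V w \<in> QP_eventually"
    if "admissible t0 T I V w" "\<forall>i\<in>I. V i t \<in> {- int N..int N'}" for N N' V w
    using that
  proof (induction "N + N'" arbitrary: N N' V w rule: less_induct)
    case less
    note outer = less.hyps
    \<comment> \<open>Adding two coefficients of opposite sign from \<open>X\<close> gives one in the same range but outside \<open>X\<close>.\<close>
    define X where "X = (if N' \<le> N then {- int N} \<union> {0<..} else {int N'} \<union> {..<0})"
    show ?case using less.prems
    proof (induction "card {l \<in> I. V l t \<in> X}" arbitrary: V w rule: less_induct)
      case (less V w)
      have I: "finite I" using adm unfolding admissible_def by simp
      show ?case
      proof (cases "(\<forall>i\<in>I. V i t \<ge> 0) \<or> (\<forall>i\<in>I. V i t \<le> 0)")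
        case True
        then show ?thesis
          using QP_eventually_lin_count_one_signed[OF zero t less.prems(1)] by blast
      next
        case False
        \<comment> \<open>Both signs occur, so either endpoint can be moved by one towards
          0.\<close>
        have N0: "N > 0 \<and> N' > 0"
        proof -
          have "- int N < 0" "int N' > 0" using False less.prems(2) by force+
          then show ?thesis by simp
        qed
        show ?thesis
        proof (cases "\<exists>i\<in>I. \<exists>j\<in>I. V i t > 0 \<and> V j t < 0 \<and> V i t \<in> X \<and> V j t \<in> X")
          case True
          then obtain i j where ij: "i \<in> I" "j \<in> I" "V i t > 0" "V j t < 0" "V i t \<in> X" "V j t \<in> X"
            by blast
          have "i \<noteq> j" using ij by auto
          have rng: "V i t \<le> int N'" "V j t \<ge> - int N" using less.prems(2) ij by auto
          have new: "V i t + V j t \<notin> X" "V i t + V j t \<in> {- int N..int N'}"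
            using ij rng unfolding X_def by (auto split: if_splits)
          \<comment> \<open>Each half of the split replaces one of the two coefficients from
            \<open>X\<close> by their sum, which lies outside \<open>X\<close>.\<close>
          have decr: "card {l \<in> I. (V(l' := \<lambda>s. V i s + V j s)) l t \<in> X} < card {l \<in> I. V l t \<in> X}"
            if "l' \<in> {i, j}" for l'
            using I that ij new by (intro psubset_card_mono) auto
          note split = admissible_split[OF less.prems(1) ij(1,2) \<open>i \<noteq> j\<close>]
          have sw: "(\<lambda>s. V j s + V i s) = (\<lambda>s. V i s + V j s)" by (simp add: add.commute)
          show ?thesis
          proof (rule split(3))
            show "lin_count t0 T I (V(j := \<lambda>s. V j s + V i s)) w \<in> QP_eventually"
              using decr[of j] new(2) less.prems(2)
              by (intro less.hyps split(1)) (auto simp: sw)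
            show "lin_count t0 T I (V(i := \<lambda>s. V i s + V j s)) (\<lambda>t. w t - V j t) \<in> QP_eventually"
              using decr[of i] new(2) less.prems(2)
              by (intro less.hyps split(2)) auto
          qed
        next
          case noX: False
          show ?thesis
          proof (cases "N' \<le> N")
            case True
            \<comment> \<open>Here every positive coefficient lies in \<open>X\<close>, and one
              exists; without a splitting pair the value \<open>- int N\<close> cannot occur, and
              the interval shrinks. The other case is symmetric.\<close>
            obtain i where "i \<in> I" "V i t > 0" using False by force
            with noX True N0 have "\<forall>j\<in>I. V j t \<noteq> - int N" unfolding X_def by force
            with less.prems(2) have "\<forall>j\<in>I. V j t \<in> {- int (N - 1)..int N'}"
              by (force simp: of_nat_diff)
            then show ?thesis using N0 by (intro outer[of "N - 1" N'] less.prems(1)) auto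
          next
            case N: False
            obtain j where "j \<in> I" "V j t < 0" using False by force
            with noX N N0 have "\<forall>i\<in>I. V i t \<noteq> int N'" unfolding X_def by force
            with less.prems(2) have "\<forall>j\<in>I. V j t \<in> {- int N..int (N' - 1)}"
              by (force simp: of_nat_diff)
            then show ?thesis using N0 by (intro outer[of N "N' - 1"] less.prems(1)) auto
          qed
        qed
      qed
    qed
  qed
  moreover have "\<exists>N. \<forall>i\<in>I. V i t \<in> {- int N..int N}"
  proof (intro exI ballI)
    fix i assume "i \<in> I"
    moreover have "finite I" using adm unfolding admissible_def by simp
    ultimately have "\<bar>V i t\<bar> \<le> (\<Sum>i\<in>I. \<bar>V i t\<bar>)" by (intro member_le_sum) auto
    then show "V i t \<in> {- int (nat (\<Sum>i\<in>I. \<bar>V i t\<bar>))..int (nat (\<Sum>i\<in>I. \<bar>V i t\<bar>))}" by auto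
  qed
  ultimately show ?thesis using adm by blast
qed

text \<open>Induction over the equations other than \<open>t0\<close>. Once \<open>t0\<close> alone
  is left, its coefficients are nonnegative and the count is a shifted denumerant or zero.\<close>

lemma QP_eventually_lin_count:
  assumes "finite T" "t0 \<notin> T" "admissible t0 T I V w"
  shows "lin_count t0 T I V w \<in> QP_eventually"
  using assms
proof (induction T arbitrary: I V w rule: finite_induct)
  case empty
  have I: "finite I" and nonneg: "\<forall>i\<in>I. V i t0 \<ge> 0"
    and fin: "\<And>n. finite (lin_sols I {t0} V (shift_at t0 w n))"
    using empty.prems unfolding admissible_def by auto
  show ?case
  proof (cases "\<exists>i\<in>I. V i t0 = 0")
    case True
    then obtain i where i: "i \<in> I" "V i t0 = 0" by blast
    \<comment> \<open>An unknown with coefficient 0 is free, so one solution would produce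
      infinitely many, against admissibility.\<close>
    have "lin_sols I {t0} V (shift_at t0 w n) = {}" for n
    proof (rule ccontr)
      assume "lin_sols I {t0} V (shift_at t0 w n) \<noteq> {}"
      then obtain x where x: "x \<in> lin_sols I {t0} V (shift_at t0 w n)" by blast
      have "(\<Sum>l\<in>I. int ((x(i := r)) l) * V l t0) = (\<Sum>l\<in>I. int (x l) * V l t0)" for r
        using i by (intro sum.cong) auto
      then have "range (\<lambda>r. x(i := r)) \<subseteq> lin_sols I {t0} V (shift_at t0 w n)"
        using x i unfolding lin_sols_def by auto
      then have "finite (range (\<lambda>r. x(i := r)))" using fin finite_subset by blast
      moreover have "inj (\<lambda>r. x(i := r))" by (rule injI) (metis fun_upd_same)
      ultimately show False using finite_imageD infinite_UNIV_nat by blast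
    qed
    then show ?thesis unfolding lin_count_def using QP_eventually_const[of 0] by simp
  next
    case False
    then have "\<And>i. i \<in> I \<Longrightarrow> V i t0 > 0" using nonneg by force
    from QP_eventually_shift[OF QP_eventually_card_denumerant[OF I, of "\<lambda>i. V i t0"], OF this, of "w t0"]
    show ?thesis unfolding lin_count_def lin_sols_def shift_at_def by (simp add: add.commute)
  qed
next
  case (insert t T)
  show ?case
  proof (rule QP_eventually_lin_count_eliminate[of t0 "insert t T" t])
    fix I :: "'b set" and V w
    assume adm: "admissible t0 (insert t T) I V w" and zero: "\<forall>i\<in>I. V i t = 0"
    show "lin_count t0 (insert t T) I V w \<in> QP_eventually"
    \<comment> \<open>A row of zeros is void or unsatisfiable according to its target, and this does
      not depend on \<open>n\<close> because \<open>t\<close> differs from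
      \<open>t0\<close>.\<close>
    proof (cases "w t = 0")
      case True
      have "lin_sols I (insert t0 (insert t T)) V (shift_at t0 w n) = lin_sols I (insert t0 T) V (shift_at t0 w n)" for n
        using zero True insert.prems unfolding lin_sols_def shift_at_def by auto
      then show ?thesis using insert.IH[of I V w] insert.prems adm
        unfolding lin_count_def admissible_def by simp
    next
      case False
      have "lin_sols I (insert t0 (insert t T)) V (shift_at t0 w n) = {}" for n
        using zero False insert.prems unfolding lin_sols_def shift_at_def by auto
      then show ?thesis unfolding lin_count_def using QP_eventually_const[of 0] by simp
    qed
  qed (use insert.prems in auto)
qed

section \<open>Digits and carries\<close>

text \<open>\<open>L\<close> holds the equations whose coefficients are still polynomials in
  \<open>n\<close> and is worked off from the front; \<open>C\<close> collects the
  constant-coefficient equations split off on the way.\<close>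

definition box_sols ::
  "'i set \<Rightarrow> (('i \<Rightarrow> int poly) \<times> int poly) list \<Rightarrow> (('i \<Rightarrow> int) \<times> int \<times> int) set \<Rightarrow> int \<Rightarrow> ('i \<Rightarrow> nat) set" where
  "box_sols I L C n = {x. (\<forall>i. i \<notin> I \<longrightarrow> x i = 0) \<and> (\<forall>i\<in>I. int (x i) < n) \<and>
     (\<forall>(p, q)\<in>set L. (\<Sum>i\<in>I. int (x i) * poly (p i) n) = poly q n) \<and>
     (\<forall>(a, b, c)\<in>C. (\<Sum>i\<in>I. int (x i) * a i) = b + c * n)}"

lemma finite_box_sols: "finite I \<Longrightarrow> finite (box_sols I L C n)"
  by (rule finite_bounded_functions[of I _ "nat n"]) (auto simp: box_sols_def)

text \<open>
  The unknowns are \<open>None\<close> for \<open>n\<close>, \<open>Some (i, False)\<close> for \<open>x\<^sub>i\<close> and \<open>Some (i, True)\<close> for the slack of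
  \<open>x\<^sub>i \<le> n - 1\<close>; equation \<open>None\<close> fixes the value of \<open>n\<close>.
\<close>

definition box_coeff :: "('i \<times> bool) option \<Rightarrow> ((('i \<Rightarrow> int) \<times> int \<times> int) + 'i) option \<Rightarrow> int" where
  "box_coeff v t = (case t of None \<Rightarrow> of_bool (v = None)
     | Some (Inl (a, b, c)) \<Rightarrow> (case v of None \<Rightarrow> - c | Some (i, s) \<Rightarrow> if s then 0 else a i)
     | Some (Inr i') \<Rightarrow> (case v of None \<Rightarrow> - 1 | Some (i, s) \<Rightarrow> of_bool (i = i')))"

definition box_rhs :: "((('i \<Rightarrow> int) \<times> int \<times> int) + 'i) option \<Rightarrow> int" where
  "box_rhs t = (case t of None \<Rightarrow> 0 | Some (Inl (a, b, c)) \<Rightarrow> b | Some (Inr i) \<Rightarrow> - 1)"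

definition box_vars :: "'i set \<Rightarrow> ('i \<times> bool) option set" where
  "box_vars I = insert None (Some ` (I \<times> UNIV))"

lemma sum_box_vars:
  assumes "finite I"
  shows "(\<Sum>v\<in>box_vars I. f v) = f None + (\<Sum>i\<in>I. f (Some (i, False)) + f (Some (i, True)))"
proof -
  have "(\<Sum>v\<in>box_vars I. f v) = f None + (\<Sum>p\<in>I \<times> UNIV. f (Some p))"
    using assms by (simp add: box_vars_def sum.reindex)
  also have "(\<Sum>p\<in>I \<times> UNIV. f (Some p)) = (\<Sum>i\<in>I. \<Sum>s\<in>UNIV. f (Some (i, s)))"
    by (simp add: sum.cartesian_product case_prod_unfold)
  finally show ?thesis by (simp add: UNIV_bool)
qed

lemma lin_sols_box_iff:
  assumes I: "finite I"
  shows "y \<in> lin_sols (box_vars I) (insert None (Some ` (Inl ` C \<union> Inr ` I))) box_coeff (shift_at None box_rhs n)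
    \<longleftrightarrow> (\<forall>i s. i \<notin> I \<longrightarrow> y (Some (i, s)) = 0) \<and> int (y None) = n \<and>
      (\<forall>(a, b, c)\<in>C. (\<Sum>i\<in>I. int (y (Some (i, False))) * a i) = b + c * n) \<and>
      (\<forall>i\<in>I. int (y (Some (i, False))) + int (y (Some (i, True))) = n - 1)"
proof -
  have delta: "(\<Sum>l\<in>I. int (y (Some (l, False))) * of_bool (l = i) + int (y (Some (l, True))) * of_bool (l = i))
      = int (y (Some (i, False))) + int (y (Some (i, True)))" if "i \<in> I" for i
  proof -
    have "(\<Sum>l\<in>I. int (y (Some (l, False))) * of_bool (l = i) + int (y (Some (l, True))) * of_bool (l = i))
      = (\<Sum>l\<in>{i}. int (y (Some (l, False))) + int (y (Some (l, True))))"
      using I that by (intro sum.mono_neutral_cong_right) auto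
    then show ?thesis by simp
  qed
  have supp: "(\<forall>v. v \<notin> box_vars I \<longrightarrow> y v = 0) \<longleftrightarrow> (\<forall>i s. i \<notin> I \<longrightarrow> y (Some (i, s)) = 0)"
    unfolding box_vars_def by (auto simp: split_option_all)
  let ?s = "\<lambda>t. \<Sum>v\<in>box_vars I. int (y v) * box_coeff v t"
  have sums: "?s None = int (y None)"
    "?s (Some (Inl e)) = (\<Sum>i\<in>I. int (y (Some (i, False))) * fst e i) - snd (snd e) * int (y None)"
    "i \<in> I \<Longrightarrow> ?s (Some (Inr i)) = int (y (Some (i, False))) + int (y (Some (i, True))) - int (y None)" for e i
    unfolding sum_box_vars[OF I] by (simp_all add: box_coeff_def delta split: prod.split)
  have rhs: "shift_at None box_rhs n None = n"
    "shift_at None box_rhs n (Some (Inl e)) = fst (snd e)"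
    "shift_at None box_rhs n (Some (Inr i)) = - 1" for e i
    by (simp_all add: shift_at_def box_rhs_def split: prod.split)
  show ?thesis
    unfolding lin_sols_def mem_Collect_eq supp
    by (simp add: sums rhs case_prod_unfold ball_Un) (auto simp: algebra_simps)
qed

text \<open>The parameter and slack equations determine the added unknowns, so forgetting them loses
  nothing; \<open>n \<ge> 0\<close> lets the natural unknown \<open>None\<close> take the value
  \<open>n\<close>.\<close>

lemma bij_betw_lin_sols_box:
  assumes I: "finite I" and n: "n \<ge> 0"
  shows "bij_betw (\<lambda>y i. y (Some (i, False)))
    (lin_sols (box_vars I) (insert None (Some ` (Inl ` C \<union> Inr ` I))) box_coeff (shift_at None box_rhs n))
    (box_sols I [] C n)"
proof (rule bij_betw_byWitness[where f' = "\<lambda>x v. case v of None \<Rightarrow> nat n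
    | Some (i, s) \<Rightarrow> if i \<in> I then if s then nat (n - 1 - int (x i)) else x i else 0"])
  show "\<forall>y\<in>lin_sols (box_vars I) (insert None (Some ` (Inl ` C \<union> Inr ` I))) box_coeff (shift_at None box_rhs n).
      (\<lambda>v. case v of None \<Rightarrow> nat n | Some (i, s) \<Rightarrow> if i \<in> I then if s then nat (n - 1 - int (y (Some (i, False))))
        else y (Some (i, False)) else 0) = y"
    unfolding lin_sols_box_iff[OF I]
  proof (intro ballI ext)
    fix y v assume "y \<in> lin_sols (box_vars I) (insert None (Some ` (Inl ` C \<union> Inr ` I))) box_coeff (shift_at None box_rhs n)"
    note y = this[unfolded lin_sols_box_iff[OF I]]
    have "nat (n - 1 - int (y (Some (i, False)))) = y (Some (i, True))" if "i \<in> I" for i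
    proof -
      have "int (y (Some (i, False))) + int (y (Some (i, True))) = n - 1" using y that by blast
      then show ?thesis by linarith
    qed
    then show "(case v of None \<Rightarrow> nat n | Some (i, s) \<Rightarrow> if i \<in> I then if s then nat (n - 1 - int (y (Some (i, False))))
        else y (Some (i, False)) else 0) = y v"
      using y by (auto split: option.split)
  qed
  show "\<forall>x\<in>box_sols I [] C n. (\<lambda>i. case Some (i, False) of None \<Rightarrow> nat n
      | Some (i, s) \<Rightarrow> if i \<in> I then if s then nat (n - 1 - int (x i)) else x i else 0) = x"
    unfolding box_sols_def by auto
  show "(\<lambda>y i. y (Some (i, False))) `
      lin_sols (box_vars I) (insert None (Some ` (Inl ` C \<union> Inr ` I))) box_coeff (shift_at None box_rhs n)
      \<subseteq> box_sols I [] C n"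
  proof (intro subsetI, elim imageE)
    fix x y assume "y \<in> lin_sols (box_vars I) (insert None (Some ` (Inl ` C \<union> Inr ` I))) box_coeff (shift_at None box_rhs n)"
      and x: "x = (\<lambda>i. y (Some (i, False)))"
    note y = this(1)[unfolded lin_sols_box_iff[OF I]]
    then have "\<forall>i\<in>I. int (y (Some (i, False))) < n" by force
    with y show "x \<in> box_sols I [] C n" unfolding x box_sols_def by simp
  qed
  show "(\<lambda>x v. case v of None \<Rightarrow> nat n
      | Some (i, s) \<Rightarrow> if i \<in> I then if s then nat (n - 1 - int (x i)) else x i else 0) ` box_sols I [] C n
    \<subseteq> lin_sols (box_vars I) (insert None (Some ` (Inl ` C \<union> Inr ` I))) box_coeff (shift_at None box_rhs n)"
  proof (intro subsetI, elim imageE)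
    fix x y assume x: "x \<in> box_sols I [] C n" and y: "y = (\<lambda>v. case v of None \<Rightarrow> nat n
      | Some (i, s) \<Rightarrow> if i \<in> I then if s then nat (n - 1 - int (x i)) else x i else 0)"
    show "y \<in> lin_sols (box_vars I) (insert None (Some ` (Inl ` C \<union> Inr ` I))) box_coeff (shift_at None box_rhs n)"
      unfolding lin_sols_box_iff[OF I] using x n unfolding y box_sols_def by simp
  qed
qed

lemma QP_eventually_card_box_sols_const:
  assumes I: "finite I" and C: "finite C"
  shows "(\<lambda>n. int (card (box_sols I [] C n))) \<in> QP_eventually"
proof -
  let ?T = "Some ` (Inl ` C \<union> Inr ` I)"
  have "finite (lin_sols (box_vars I) (insert None ?T) box_coeff (shift_at None box_rhs n))" for n
  proof (cases "n \<ge> 0")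
    case True
    then show ?thesis using bij_betw_finite[OF bij_betw_lin_sols_box[OF I]] finite_box_sols[OF I] by blast
  next
    case False
    \<comment> \<open>A natural unknown cannot take the negative value \<open>n\<close>.\<close>
    then have "lin_sols (box_vars I) (insert None ?T) box_coeff (shift_at None box_rhs n) = {}"
      using lin_sols_box_iff[OF I, of _ C n] by fastforce
    then show ?thesis by simp
  qed
  moreover have "finite (box_vars I)" using I by (simp add: box_vars_def)
  ultimately have "admissible None ?T (box_vars I) box_coeff box_rhs"
    unfolding admissible_def by (simp add: box_coeff_def)
  then have "lin_count None ?T (box_vars I) box_coeff box_rhs \<in> QP_eventually"
    using I C by (intro QP_eventually_lin_count) auto
  moreover have "\<forall>\<^sub>F n in at_top. int (card (box_sols I [] C n)) = lin_count None ?T (box_vars I) box_coeff box_rhs n"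
    using eventually_ge_at_top[of 0]
    by eventually_elim (simp add: lin_count_def bij_betw_same_card[OF bij_betw_lin_sols_box[OF I]])
  ultimately show ?thesis by (rule QP_eventually_cong)
qed

section \<open>Reduction of the degree by carries\<close>

text \<open>Modulo \<open>n\<close> only the constant terms remain, so the two sides of the constant
  part differ by \<open>t * n\<close> for a carry \<open>t\<close>. As each \<open>x i\<close> is
  below \<open>n\<close>, this difference is at most \<open>n * B\<close> in absolute value, which
  bounds \<open>t\<close> independently of \<open>n\<close>.\<close>

lemma box_sols_carry:
  assumes I: "finite I" and n: "n > 0"
    and p: "\<And>i. p i = pCons (p0 i) (p' i)" and q: "q = pCons q0 q'"
  defines "B \<equiv> (\<Sum>i\<in>I. \<bar>p0 i\<bar>) + \<bar>q0\<bar>"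
  shows "box_sols I ((p, q) # L) C n
    = (\<Union>t\<in>{-B..B}. box_sols I ((p', q' - [:t:]) # L) (insert (p0, q0, t) C) n)" (is "?L = ?R")
proof -
  have eq: "(\<Sum>i\<in>I. int (x i) * poly (p i) n)
      = (\<Sum>i\<in>I. int (x i) * p0 i) + n * (\<Sum>i\<in>I. int (x i) * poly (p' i) n)" for x
    by (simp add: p sum_distrib_left sum.distrib[symmetric] algebra_simps)
  have carry: "\<exists>t\<in>{-B..B}. (\<Sum>i\<in>I. int (x i) * p0 i) = q0 + t * n \<and> (\<Sum>i\<in>I. int (x i) * poly (p' i) n) = poly (q' - [:t:]) n"
    if x: "\<forall>i\<in>I. int (x i) < n" and s: "(\<Sum>i\<in>I. int (x i) * poly (p i) n) = poly q n" for x
  proof -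
    \<comment> \<open>The carry is what the higher-degree part lacks and the constant part has to
      supply.\<close>
    define t where "t = poly q' n - (\<Sum>i\<in>I. int (x i) * poly (p' i) n)"
    have st: "(\<Sum>i\<in>I. int (x i) * p0 i) = q0 + t * n"
      using s unfolding eq q t_def by (simp add: algebra_simps)
    have "\<bar>\<Sum>i\<in>I. int (x i) * p0 i\<bar> \<le> (\<Sum>i\<in>I. \<bar>int (x i) * p0 i\<bar>)" by (rule sum_abs)
    also have "\<dots> \<le> (\<Sum>i\<in>I. n * \<bar>p0 i\<bar>)"
      using x by (intro sum_mono) (auto simp: abs_mult intro!: mult_right_mono)
    finally have "\<bar>\<Sum>i\<in>I. int (x i) * p0 i\<bar> \<le> n * (\<Sum>i\<in>I. \<bar>p0 i\<bar>)" by (simp add: sum_distrib_left)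
    moreover have "\<bar>q0\<bar> \<le> n * \<bar>q0\<bar>" using n mult_right_mono[of 1 n "\<bar>q0\<bar>"] by simp
    ultimately have "\<bar>t * n\<bar> \<le> n * B" using st unfolding B_def by (simp add: distrib_left)
    then have "n * \<bar>t\<bar> \<le> n * B" using n by (simp add: abs_mult mult.commute)
    then have "\<bar>t\<bar> \<le> B" using n by simp
    then show ?thesis using st by (intro bexI[of _ t]) (auto simp: t_def)
  qed
  have converse: "(\<Sum>i\<in>I. int (x i) * poly (p i) n) = poly q n"
    if "(\<Sum>i\<in>I. int (x i) * p0 i) = q0 + t * n" "(\<Sum>i\<in>I. int (x i) * poly (p' i) n) = poly (q' - [:t:]) n" for x t
    unfolding eq that q by (simp add: algebra_simps)
  show ?thesis
  proof (intro equalityI subsetI)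
    fix x assume x: "x \<in> ?L"
    then obtain t where "t\<in>{-B..B}" "(\<Sum>i\<in>I. int (x i) * p0 i) = q0 + t * n"
      "(\<Sum>i\<in>I. int (x i) * poly (p' i) n) = poly (q' - [:t:]) n"
      using carry[of x] unfolding box_sols_def by auto
    with x show "x \<in> ?R" unfolding box_sols_def by auto
  next
    fix x assume "x \<in> ?R"
    then obtain t where x: "x \<in> box_sols I ((p', q' - [:t:]) # L) (insert (p0, q0, t) C) n" by blast
    then show "x \<in> ?L" using converse[of x t] unfolding box_sols_def by auto
  qed
qed

text \<open>Each carry step strips the constant coefficients and lowers the bound \<open>u\<close>.
  Admitting \<open>p i = 0\<close> lets \<open>u = 0\<close> mean that all coefficients have
  vanished.\<close>

lemma QP_eventually_card_box_sols_Cons: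
  assumes I: "finite I"
    and tail: "\<And>C. finite C \<Longrightarrow> (\<lambda>n. int (card (box_sols I L C n))) \<in> QP_eventually"
    and "\<And>i. degree (p i) < u \<or> p i = 0" and "finite C"
  shows "(\<lambda>n. int (card (box_sols I ((p, q) # L) C n))) \<in> QP_eventually"
  using assms(3,4)
proof (induction u arbitrary: p q C)
  case 0
  then have p: "p i = 0" for i by simp
  show ?case
  proof (cases "q = 0")
    case True
    then have "box_sols I ((p, q) # L) C n = box_sols I L C n" for n
      unfolding box_sols_def by (auto simp: p)
    then show ?thesis using tail[OF 0(2)] by simp
  next
    case False
    \<comment> \<open>The equation now reads \<open>0 = poly q n\<close>, which fails beyond the
      finitely many roots of \<open>q\<close>.\<close>
    have "finite {n. poly q n = 0}" using False by (rule poly_roots_finite)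
    then obtain N where N: "\<And>n. poly q n = 0 \<Longrightarrow> n \<le> N"
      by (metis (mono_tags) bdd_above_def bdd_above_finite mem_Collect_eq)
    have "\<forall>\<^sub>F n in at_top. int (card (box_sols I ((p, q) # L) C n)) = 0"
      using eventually_gt_at_top[of N]
    proof eventually_elim
      case (elim n)
      then have "poly q n \<noteq> 0" using N[of n] by force
      then have "box_sols I ((p, q) # L) C n = {}" unfolding box_sols_def by (auto simp: p)
      then show ?case by simp
    qed
    then show ?thesis by (rule QP_eventually_cong[OF QP_eventually_const])
  qed
next
  case (Suc u)
  define p0 p' where "p0 i = coeff (p i) 0" and "p' i = poly_shift 1 (p i)" for i
  define q0 q' where "q0 = coeff q 0" and "q' = poly_shift 1 q"
  have shift: "r = pCons (coeff r 0) (poly_shift 1 r)" for r :: "int poly"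
    by (rule poly_eqI) (simp add: coeff_pCons coeff_poly_shift split: nat.split)
  have deg: "degree (p' i) < u \<or> p' i = 0" for i
  proof -
    have "p i = pCons (p0 i) (p' i)" unfolding p0_def p'_def by (rule shift)
    then show ?thesis using Suc.prems(1)[of i] by (auto split: if_splits)
  qed
  define B where "B = (\<Sum>i\<in>I. \<bar>p0 i\<bar>) + \<bar>q0\<bar>"
  let ?S = "\<lambda>t n. box_sols I ((p', q' - [:t:]) # L) (insert (p0, q0, t) C) n"
  have "(\<lambda>n. \<Sum>t\<in>{-B..B}. int (card (?S t n))) \<in> QP_eventually"
    by (intro QP_eventually_sum Suc.IH deg) (use Suc.prems in simp)
  moreover have "\<forall>\<^sub>F n in at_top. int (card (box_sols I ((p, q) # L) C n)) = (\<Sum>t\<in>{-B..B}. int (card (?S t n)))"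
    using eventually_gt_at_top[of 0]
  proof eventually_elim
    case (elim n)
    have "box_sols I ((p, q) # L) C n = (\<Union>t\<in>{-B..B}. ?S t n)"
      unfolding B_def using shift by (intro box_sols_carry I elim) (simp_all add: p0_def p'_def q0_def q'_def)
    \<comment> \<open>The equation \<open>(p0, q0, t)\<close> determines \<open>t\<close> from
      \<open>x\<close> because \<open>n > 0\<close>.\<close>
    moreover have "?S t n \<inter> ?S t' n = {}" if "t \<noteq> t'" for t t'
      using that elim unfolding box_sols_def by auto
    ultimately have "card (box_sols I ((p, q) # L) C n) = (\<Sum>t\<in>{-B..B}. card (?S t n))"
      using finite_box_sols[OF I] by (simp add: card_UN_disjoint)
    then show ?case by simp
  qed
  ultimately show ?case by (rule QP_eventually_cong)
qed

lemma QP_eventually_card_box_sols: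
  assumes I: "finite I" and C: "finite C"
  shows "(\<lambda>n. int (card (box_sols I L C n))) \<in> QP_eventually"
  using C
proof (induction L arbitrary: C)
  case Nil
  then show ?case by (rule QP_eventually_card_box_sols_const[OF I])
next
  case (Cons e L)
  obtain p q where e: "e = (p, q)" by (cases e)
  \<comment> \<open>Zero coefficients off \<open>I\<close> make a single degree bound valid for all
    indices.\<close>
  define p' where "p' i = (if i \<in> I then p i else 0)" for i
  have "box_sols I ((p, q) # L) C n = box_sols I ((p', q) # L) C n" for n C
    unfolding box_sols_def p'_def by (simp cong: sum.cong)
  moreover have "degree (p' i) < Suc (Max (degree ` p ` I)) \<or> p' i = 0" for i
    using I by (auto simp: p'_def less_Suc_eq_le)
  from QP_eventually_card_box_sols_Cons[OF I Cons.IH this Cons.prems]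
  have "(\<lambda>n. int (card (box_sols I ((p', q) # L) C n))) \<in> QP_eventually" by simp
  ultimately show ?case unfolding e by simp
qed

section \<open>Fourier-Motzkin elimination and the size of solutions\<close>

text \<open>Values are rational because extending a solution divides by coefficients; the
  inequalities are homogeneous, so solutions may be scaled.\<close>

definition satisfies :: "'v set \<Rightarrow> ('v \<Rightarrow> int) set \<Rightarrow> ('v \<Rightarrow> rat) \<Rightarrow> bool" where
  "satisfies W C y \<longleftrightarrow> (\<forall>a\<in>C. (\<Sum>v\<in>W. of_int (a v) * y v) \<ge> 0)"

text \<open>Each new row combines a lower and an upper bound on \<open>u\<close> with the positive
  factors \<open>- b u\<close> and \<open>a u\<close>, so that \<open>u\<close> cancels.
  Cross-multiplication keeps the coefficients integral.\<close>

definition fm_elim :: "'v \<Rightarrow> ('v \<Rightarrow> int) set \<Rightarrow> ('v \<Rightarrow> int) set" where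
  "fm_elim u C = {a \<in> C. a u = 0} \<union>
     (\<lambda>(a, b) v. a u * b v - b u * a v) ` ({a \<in> C. a u > 0} \<times> {b \<in> C. b u < 0})"

lemma finite_fm_elim: "finite C \<Longrightarrow> finite (fm_elim u C)"
  unfolding fm_elim_def by simp

lemma fm_elim_eq_zero: "a \<in> fm_elim u C \<Longrightarrow> a u = 0"
  unfolding fm_elim_def by (auto simp: mult.commute)

lemma fm_elim_preserves_zero:
  assumes "\<forall>a\<in>C. a v = 0" "a \<in> fm_elim u C"
  shows "a v = 0"
proof -
  consider "a \<in> C" | p q where "p \<in> C" "q \<in> C" "a = (\<lambda>v. p u * q v - q u * p v)"
    using assms(2) unfolding fm_elim_def by auto
  then show ?thesis using assms(1) by cases (blast, metis diff_zero mult_zero_right)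
qed

lemma fm_elim_bound:
  assumes "\<And>a v. a \<in> C \<Longrightarrow> \<bar>a v\<bar> \<le> N" "N \<ge> 1" "a \<in> fm_elim u C"
  shows "\<bar>a v\<bar> \<le> 2 * N\<^sup>2"
  using assms(3) unfolding fm_elim_def
proof
  assume "a \<in> {a \<in> C. a u = 0}"
  then have "\<bar>a v\<bar> \<le> N" using assms(1) by simp
  also have "N \<le> N * N" using assms(2) mult_left_mono[of 1 N N] by simp
  finally show ?thesis by (simp add: power2_eq_square)
next
  assume "a \<in> (\<lambda>(a, b) v. a u * b v - b u * a v) ` ({a \<in> C. a u > 0} \<times> {b \<in> C. b u < 0})"
  then obtain p q where pq: "p \<in> C" "q \<in> C" "a = (\<lambda>v. p u * q v - q u * p v)" by auto
  have "\<bar>p u * q v\<bar> \<le> N * N" "\<bar>q u * p v\<bar> \<le> N * N"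
    unfolding abs_mult using pq assms(1,2) by (auto intro!: mult_mono)
  then show ?thesis unfolding pq(3) power2_eq_square by linarith
qed

lemma satisfies_fm_elim:
  assumes "satisfies W C y"
  shows "satisfies W (fm_elim u C) y"
  unfolding satisfies_def
proof
  fix c assume "c \<in> fm_elim u C"
  then show "(\<Sum>v\<in>W. of_int (c v) * y v) \<ge> 0" unfolding fm_elim_def
  proof
    assume "c \<in> {a \<in> C. a u = 0}"
    then show ?thesis using assms unfolding satisfies_def by simp
  next
    assume "c \<in> (\<lambda>(a, b) v. a u * b v - b u * a v) ` ({a \<in> C. a u > 0} \<times> {b \<in> C. b u < 0})"
    then obtain a b where ab: "a \<in> C" "a u > 0" "b \<in> C" "b u < 0" "c = (\<lambda>v. a u * b v - b u * a v)"
      by auto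
    have "(\<Sum>v\<in>W. of_int (c v) * y v) = of_int (a u) * (\<Sum>v\<in>W. of_int (b v) * y v)
        + of_int (- b u) * (\<Sum>v\<in>W. of_int (a v) * y v)"
      unfolding ab(5) by (simp add: sum_distrib_left sum.distrib[symmetric] sum_subtractf[symmetric] algebra_simps)
    moreover have "(\<Sum>v\<in>W. of_int (b v) * y v) \<ge> 0" "(\<Sum>v\<in>W. of_int (a v) * y v) \<ge> 0"
      using assms ab unfolding satisfies_def by auto
    moreover have "rat_of_int (a u) \<ge> 0" "rat_of_int (- b u) \<ge> 0" using ab by simp_all
    ultimately show ?thesis by (metis add_nonneg_nonneg mult_nonneg_nonneg)
  qed
qed

lemma exists_between_finite:
  fixes L U :: "'a :: linorder set"
  assumes "finite L" "finite U" "\<And>l u. l \<in> L \<Longrightarrow> u \<in> U \<Longrightarrow> l \<le> u"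
  shows "\<exists>z. (\<forall>l\<in>L. l \<le> z) \<and> (\<forall>u\<in>U. z \<le> u)"
proof (cases "L = {}")
  case True
  then show ?thesis using assms(2) by (cases "U = {}") (auto intro!: exI[of _ "Min U"])
next
  case False
  then show ?thesis using assms by (intro exI[of _ "Max L"]) auto
qed

text \<open>Solved for \<open>u\<close>, rows with positive coefficient are lower bounds and rows
  with negative coefficient upper bounds. The combined rows place each lower bound below each upper
  bound, which leaves room for a value \<open>z\<close>.\<close>

lemma satisfies_fm_elim_extend:
  assumes W: "finite W" "u \<in> W" and C: "finite C" and sat: "satisfies W (fm_elim u C) y"
  shows "\<exists>z. satisfies W C (y(u := z))"
proof -
  define R where "R a = (\<Sum>v\<in>W - {u}. rat_of_int (a v) * y v)" for a
  have sum: "(\<Sum>v\<in>W. of_int (a v) * (y(u := z)) v) = of_int (a u) * z + R a" for a z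
  proof -
    have "(\<Sum>v\<in>W - {u}. of_int (a v) * (y(u := z)) v) = R a"
      unfolding R_def by (rule sum.cong) auto
    then show ?thesis using W by (simp add: sum.remove)
  qed
  have satR: "R c \<ge> 0" if "c \<in> fm_elim u C" for c
  proof -
    have "(\<Sum>v\<in>W. of_int (c v) * (y(u := y u)) v) \<ge> 0"
      using sat that unfolding satisfies_def by simp
    then show ?thesis unfolding sum fm_elim_eq_zero[OF that] by simp
  qed
  obtain z where z: "\<And>a. a \<in> C \<Longrightarrow> a u > 0 \<Longrightarrow> - R a / of_int (a u) \<le> z"
    "\<And>b. b \<in> C \<Longrightarrow> b u < 0 \<Longrightarrow> z \<le> - R b / of_int (b u)"
  proof -
    have "\<exists>z. (\<forall>l\<in>(\<lambda>a. - R a / of_int (a u)) ` {a \<in> C. a u > 0}. l \<le> z)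
        \<and> (\<forall>r\<in>(\<lambda>b. - R b / of_int (b u)) ` {b \<in> C. b u < 0}. z \<le> r)"
    proof (rule exists_between_finite)
      fix l r assume "l \<in> (\<lambda>a. - R a / of_int (a u)) ` {a \<in> C. a u > 0}"
        "r \<in> (\<lambda>b. - R b / of_int (b u)) ` {b \<in> C. b u < 0}"
      then obtain a b where ab: "a \<in> C" "a u > 0" "b \<in> C" "b u < 0"
        "l = - R a / of_int (a u)" "r = - R b / of_int (b u)" by auto
      have "(\<lambda>v. a u * b v - b u * a v) \<in> fm_elim u C" using ab unfolding fm_elim_def by auto
      from satR[OF this] have "of_int (a u) * R b - of_int (b u) * R a \<ge> 0"
        unfolding R_def by (simp add: sum_distrib_left sum_subtractf[symmetric] algebra_simps)
      moreover have "rat_of_int (a u) > 0" "rat_of_int (b u) < 0" using ab by simp_all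
      ultimately show "l \<le> r" unfolding ab by (simp add: field_simps)
    qed (use C in auto)
    then show thesis using that by auto
  qed
  have "satisfies W C (y(u := z))" unfolding satisfies_def sum
  proof
    fix a assume a: "a \<in> C"
    consider "a u = 0" | "a u > 0" | "a u < 0" by linarith
    then show "of_int (a u) * z + R a \<ge> 0"
    proof cases
      case 1
      then have "a \<in> fm_elim u C" using a unfolding fm_elim_def by simp
      then show ?thesis using satR 1 by simp
    next
      case 2
      then have "rat_of_int (a u) > 0" by simp
      then show ?thesis using z(1)[OF a 2] by (simp add: field_simps)
    next
      case 3
      then have "rat_of_int (a u) < 0" by simp
      then show ?thesis using z(2)[OF a 3] by (simp add: field_simps)
    qed
  qed
  then show ?thesis by blast
qed

text \<open>The bound rests on \<open>2 (2 N\<^sup>2) = (2 N)\<^sup>2\<close>: each elimination squares \<open>2 N\<close>.\<close>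

lemma fm_elim_iterate:
  assumes W: "finite W" "set us \<subseteq> W" and C: "finite C" and N: "N \<ge> 1"
    and bound: "\<forall>a\<in>C. \<forall>v. \<bar>a v\<bar> \<le> N"
  defines "D \<equiv> fold fm_elim us C"
  shows "satisfies W C y \<Longrightarrow> satisfies W D y"
    and "satisfies W D y \<Longrightarrow> \<exists>y'. satisfies W C y' \<and> (\<forall>v. v \<notin> set us \<longrightarrow> y' v = y v)"
    and "a \<in> D \<Longrightarrow> v \<in> set us \<or> (\<forall>a\<in>C. a v = 0) \<Longrightarrow> a v = 0"
    and "a \<in> D \<Longrightarrow> \<bar>a v\<bar> \<le> (2 * N) ^ 2 ^ length us"
proof -
  have "(satisfies W C y \<longrightarrow> satisfies W (fold fm_elim us C) y)
    \<and> (satisfies W (fold fm_elim us C) y \<longrightarrow> (\<exists>y'. satisfies W C y' \<and> (\<forall>v. v \<notin> set us \<longrightarrow> y' v = y v)))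
    \<and> (\<forall>a\<in>fold fm_elim us C. \<forall>v. v \<in> set us \<or> (\<forall>a\<in>C. a v = 0) \<longrightarrow> a v = 0)
    \<and> (\<forall>a\<in>fold fm_elim us C. \<forall>v. \<bar>a v\<bar> \<le> (2 * N) ^ 2 ^ length us)"
    using W(2) C N bound
  proof (induction us arbitrary: C N)
    case Nil
    have "\<bar>a v\<bar> \<le> 2 * N" if "a \<in> C" for a v
      using bspec[OF Nil.prems(4) that, THEN spec, of v] Nil.prems(3) by linarith
    then show ?case by auto
  next
    case (Cons u us)
    have N2: "2 * N\<^sup>2 \<ge> 1" using Cons.prems(3) by (metis mult_2 power2_eq_square one_le_power add_increasing zero_le_one order_trans)
    have IH: "(satisfies W (fm_elim u C) y \<longrightarrow> satisfies W (fold fm_elim (u # us) C) y)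
      \<and> (satisfies W (fold fm_elim (u # us) C) y \<longrightarrow>
          (\<exists>y'. satisfies W (fm_elim u C) y' \<and> (\<forall>v. v \<notin> set us \<longrightarrow> y' v = y v)))
      \<and> (\<forall>a\<in>fold fm_elim (u # us) C. \<forall>v. v \<in> set us \<or> (\<forall>a\<in>fm_elim u C. a v = 0) \<longrightarrow> a v = 0)
      \<and> (\<forall>a\<in>fold fm_elim (u # us) C. \<forall>v. \<bar>a v\<bar> \<le> (2 * (2 * N\<^sup>2)) ^ 2 ^ length us)"
      using Cons.IH[of "fm_elim u C" "2 * N\<^sup>2"] Cons.prems N2
        finite_fm_elim[of C u] fm_elim_bound[of C N _ u] by simp
    have pow: "(2 * (2 * N\<^sup>2)) ^ 2 ^ length us = (2 * N) ^ 2 ^ length (u # us)"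
    proof -
      have "2 * (2 * N\<^sup>2) = (2 * N)\<^sup>2" by (simp add: power2_eq_square)
      then show ?thesis by (simp only: power_mult[symmetric] list.size) simp
    qed
    have "\<exists>y'. satisfies W C y' \<and> (\<forall>v. v \<notin> set (u # us) \<longrightarrow> y' v = y v)"
      if sat: "satisfies W (fold fm_elim (u # us) C) y"
    proof -
      obtain y' where y': "satisfies W (fm_elim u C) y'" "\<forall>v. v \<notin> set us \<longrightarrow> y' v = y v"
        using IH sat by blast
      obtain z where "satisfies W C (y'(u := z))"
        using satisfies_fm_elim_extend[OF W(1) _ Cons.prems(2) y'(1)] Cons.prems(1) by auto
      then show ?thesis using y'(2) by (intro exI[of _ "y'(u := z)"]) auto
    qed
    moreover have "a v = 0" if "a \<in> fold fm_elim (u # us) C" "v \<in> set (u # us) \<or> (\<forall>a\<in>C. a v = 0)" for a v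
    proof -
      have "v \<in> set us \<or> (\<forall>a\<in>fm_elim u C. a v = 0)"
        using that(2) fm_elim_eq_zero fm_elim_preserves_zero by (metis set_ConsD)
      then show ?thesis using IH that(1) by blast
    qed
    moreover have "satisfies W (fold fm_elim (u # us) C) y" if "satisfies W C y"
      using IH satisfies_fm_elim[OF that] by simp
    moreover have "\<forall>a\<in>fold fm_elim (u # us) C. \<forall>v. \<bar>a v\<bar> \<le> (2 * N) ^ 2 ^ length (u # us)"
      using IH unfolding pow by simp
    ultimately show ?case by (intro conjI impI) (assumption | intro ballI allI impI)+
  qed
  then show "satisfies W C y \<Longrightarrow> satisfies W D y"
    "satisfies W D y \<Longrightarrow> \<exists>y'. satisfies W C y' \<and> (\<forall>v. v \<notin> set us \<longrightarrow> y' v = y v)"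
    "a \<in> D \<Longrightarrow> v \<in> set us \<or> (\<forall>a\<in>C. a v = 0) \<Longrightarrow> a v = 0"
    "a \<in> D \<Longrightarrow> \<bar>a v\<bar> \<le> (2 * N) ^ 2 ^ length us"
    unfolding D_def by blast+
qed

section \<open>Recession vectors and the bound on solutions\<close>

lemma common_denominator:
  fixes y :: "'v \<Rightarrow> rat"
  assumes "finite W"
  shows "\<exists>K :: int. K > 0 \<and> (\<forall>v\<in>W. of_int K * y v \<in> \<int>)"
  using assms
proof (induction W rule: finite_induct)
  case empty
  then show ?case by (intro exI[of _ 1]) simp
next
  case (insert v W)
  then obtain K where K: "K > 0" "\<forall>v\<in>W. of_int K * y v \<in> \<int>" by blast
  obtain p q where pq: "quotient_of (y v) = (p, q)" by (cases "quotient_of (y v)")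
  then have q: "q > 0" "y v = of_int p / of_int q"
    using quotient_of_denom_pos quotient_of_div by auto
  have "of_int (q * K) * y u \<in> \<int>" if "u \<in> insert v W" for u
  proof (cases "u = v")
    case True
    then have "of_int (q * K) * y u = of_int (K * p)" using q by simp
    then show ?thesis by (metis Ints_of_int)
  next
    case False
    then have "of_int K * y u \<in> \<int>" using K that by simp
    from Ints_mult[OF Ints_of_int[of q] this] show ?thesis by (simp add: mult.assoc)
  qed
  then show ?case using q K by (intro exI[of _ "q * K"]) simp
qed

text \<open>All \<open>x + m z\<close> are solutions, and the entry at \<open>j\<close> tells them
  apart.\<close>

lemma infinite_lin_sols_of_recession:
  assumes x: "x \<in> lin_sols J R V c" and z: "z \<in> lin_sols J R V (\<lambda>_. 0)" and j: "z j > 0"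
  shows "infinite (lin_sols J R V c)"
proof
  assume fin: "finite (lin_sols J R V c)"
  have "(\<Sum>l\<in>J. int (x l + m * z l) * V l r) = c r" if "r \<in> R" for m r
  proof -
    have "(\<Sum>l\<in>J. int (x l + m * z l) * V l r)
        = (\<Sum>l\<in>J. int (x l) * V l r) + int m * (\<Sum>l\<in>J. int (z l) * V l r)"
      by (simp add: sum_distrib_left sum.distrib[symmetric] algebra_simps)
    then show ?thesis using x z that unfolding lin_sols_def by simp
  qed
  then have "range (\<lambda>m l. x l + m * z l) \<subseteq> lin_sols J R V c"
    using x z unfolding lin_sols_def by auto
  moreover have "inj (\<lambda>m l. x l + m * z l)"
  proof (rule injI)
    fix m m' assume "(\<lambda>l. x l + m * z l) = (\<lambda>l. x l + m' * z l)"
    then have "x j + m * z j = x j + m' * z j" by meson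
    then show "m = m'" using j by simp
  qed
  ultimately show False using fin finite_subset finite_imageD infinite_UNIV_nat by blast
qed

text \<open>Eliminating every unknown but \<open>x j\<close> leaves inequalities in
  \<open>x j\<close> alone. If one has a negative coefficient, its constant term bounds
  \<open>x j\<close>; otherwise \<open>x j\<close> can grow freely, which yields a recession vector
  and contradicts finiteness.\<close>

lemma lin_sols_bound:
  assumes J: "finite J" and R: "finite R" and fin: "finite (lin_sols J R V c)"
    and N: "N \<ge> 1" "\<And>j r. j \<in> J \<Longrightarrow> r \<in> R \<Longrightarrow> \<bar>V j r\<bar> \<le> N" "\<And>r. r \<in> R \<Longrightarrow> \<bar>c r\<bar> \<le> N"
    and x: "x \<in> lin_sols J R V c"
  shows "int (x j) \<le> (2 * N) ^ 2 ^ card J"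
proof (cases "j \<in> J")
  case False
  then show ?thesis using x N(1) unfolding lin_sols_def by simp
next
  case j: True
  \<comment> \<open>\<open>None\<close> is the homogenising variable: solutions have value 1 there, recession vectors 0.\<close>
  define W where "W = insert None (Some ` J)"
  \<comment> \<open>The value 0 off \<open>J\<close> makes the bound \<open>N\<close> hold at every
    index, as \<open>fm_elim_iterate\<close> demands.\<close>
  define row where "row r v = (case v of None \<Rightarrow> - c r | Some j \<Rightarrow> if j \<in> J then V j r else 0)" for r v
  \<comment> \<open>Elimination handles inequalities only, so each equation enters with both
    signs.\<close>
  define C where "C = row ` R \<union> (\<lambda>r v. - row r v) ` R \<union> (\<lambda>j v. of_bool (v = Some j)) ` J"
  obtain us where us: "set us = Some ` (J - {j})" "distinct us"
    using finite_distinct_list[of "Some ` (J - {j})"] J by auto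
  have len: "length us \<le> card J"
    using us J by (metis card_Diff1_le card_image distinct_card inj_Some)
  define D where "D = fold fm_elim us C"
  have W: "finite W" "set us \<subseteq> W" "None \<notin> set us" "Some j \<notin> set us" using J us by (auto simp: W_def)
  have C: "finite C" using J R by (simp add: C_def)
  have row: "\<bar>row r v\<bar> \<le> N" if "r \<in> R" for r v
    using that N by (auto simp: row_def split: option.split)
  have bnd: "\<forall>a\<in>C. \<forall>v. \<bar>a v\<bar> \<le> N"
    using row N(1) unfolding C_def by auto
  note fm = fm_elim_iterate[OF W(1,2) C N(1) bnd, folded D_def]
  have sumW: "(\<Sum>v\<in>W. f v) = f None + (\<Sum>l\<in>J. f (Some l))" for f :: "'a option \<Rightarrow> rat"
    using J by (simp add: W_def sum.reindex)
  have sumrow: "(\<Sum>v\<in>W. of_int (row r v) * y v) = (\<Sum>l\<in>J. y (Some l) * of_int (V l r)) - of_int (c r) * y None"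
    for r and y :: "'a option \<Rightarrow> rat"
    unfolding sumW row_def by (simp add: mult.commute cong: sum.cong)
  have sumD: "(\<Sum>v\<in>W. of_int (a v) * y v) = of_int (a None) * y None + of_int (a (Some j)) * y (Some j)"
    if "a \<in> D" for a and y :: "'a option \<Rightarrow> rat"
  proof -
    have "(\<Sum>l\<in>J. of_int (a (Some l)) * y (Some l)) = (\<Sum>l\<in>{j}. of_int (a (Some l)) * y (Some l))"
      using J j fm(3)[OF that] us(1) by (intro sum.mono_neutral_right) auto
    then show ?thesis by (simp add: sumW)
  qed
  have sumneg: "(\<Sum>v\<in>W. of_int (- row r v) * y v) = - (\<Sum>v\<in>W. of_int (row r v) * y v)"
    for r and y :: "'a option \<Rightarrow> rat"
    by (simp add: sum_negf)
  define y0 :: "'a option \<Rightarrow> rat" where "y0 v = (case v of None \<Rightarrow> 1 | Some j \<Rightarrow> of_nat (x j))" for v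
  have "satisfies W C y0" unfolding satisfies_def
  proof
    fix a assume "a \<in> C"
    moreover have "(\<Sum>v\<in>W. of_int (row r v) * y0 v) = 0" if "r \<in> R" for r
    proof -
      have "(\<Sum>l\<in>J. int (x l) * V l r) = c r" using x that unfolding lin_sols_def by simp
      then have "rat_of_int (\<Sum>l\<in>J. int (x l) * V l r) = of_int (c r)" by simp
      then show ?thesis by (simp add: sumrow y0_def)
    qed
    moreover have "(\<Sum>v\<in>W. of_int (of_bool (v = Some l)) * y0 v) \<ge> 0" for l
      by (intro sum_nonneg) (simp add: y0_def split: option.split)
    ultimately show "(\<Sum>v\<in>W. of_int (a v) * y0 v) \<ge> 0"
      unfolding C_def by (elim UnE imageE) (simp_all add: sum_negf)
  qed
  then have sat0: "satisfies W D y0" by (rule fm(1))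
  show ?thesis
  proof (cases "\<exists>a\<in>D. a (Some j) < 0")
    case True
    then obtain a where a: "a \<in> D" "a (Some j) < 0" by blast
    have "(\<Sum>v\<in>W. of_int (a v) * y0 v) \<ge> 0" using sat0 a(1) unfolding satisfies_def by blast
    then have "of_int (a None) + rat_of_int (a (Some j)) * of_nat (x j) \<ge> 0"
      unfolding sumD[OF a(1)] by (simp add: y0_def)
    then have "rat_of_int (a None + a (Some j) * int (x j)) \<ge> 0" by simp
    then have "a None + a (Some j) * int (x j) \<ge> 0" by (simp only: of_int_0_le_iff)
    \<comment> \<open>By integrality a negative coefficient is at most -1, so the constant term
      bounds \<open>x j\<close> without division.\<close>
    moreover have "a (Some j) * int (x j) \<le> - 1 * int (x j)"
      using a(2) by (intro mult_right_mono) auto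
    ultimately have "int (x j) \<le> \<bar>a None\<bar>" by linarith
    also have "\<dots> \<le> (2 * N) ^ 2 ^ length us" by (rule fm(4)[OF a(1)])
    also have "\<dots> \<le> (2 * N) ^ 2 ^ card J" using len N(1) by (intro power_increasing) auto
    finally show ?thesis .
  next
    case False
    \<comment> \<open>The ray along \<open>x j\<close>: no inequality in \<open>D\<close> has a
      negative coefficient there, and the value 0 at \<open>None\<close> makes its extension a
      kernel vector.\<close>
    define y1 :: "'a option \<Rightarrow> rat" where "y1 v = of_bool (v = Some j)" for v
    have "satisfies W D y1" unfolding satisfies_def
    proof
      fix a assume a: "a \<in> D"
      then have "a (Some j) \<ge> 0" using False by force
      then show "(\<Sum>v\<in>W. of_int (a v) * y1 v) \<ge> 0" unfolding sumD[OF a] by (simp add: y1_def)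
    qed
    from fm(2)[OF this] obtain y where y: "satisfies W C y" "y None = 0" "y (Some j) = 1"
      using W(3,4) by (auto simp: y1_def)
    have ker: "(\<Sum>l\<in>J. y (Some l) * of_int (V l r)) = 0" if "r \<in> R" for r
    proof -
      have "row r \<in> C" "(\<lambda>v. - row r v) \<in> C" using that by (auto simp: C_def)
      from this[THEN bspec[OF y(1)[unfolded satisfies_def]]]
      show ?thesis unfolding sumneg sumrow y(2) by simp
    qed
    have nonneg: "y (Some l) \<ge> 0" if l: "l \<in> J" for l
    proof -
      have "(\<lambda>v. of_bool (v = Some l)) \<in> C" using l by (auto simp: C_def)
      from bspec[OF y(1)[unfolded satisfies_def] this]
      have "(\<Sum>v\<in>W. of_int (of_bool (v = Some l)) * y v) \<ge> 0" .
      also have "(\<Sum>v\<in>W. of_int (of_bool (v = Some l)) * y v) = (\<Sum>v\<in>{Some l}. y v)"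
        using W(1) l by (intro sum.mono_neutral_cong_right) (auto simp: W_def)
      finally show ?thesis by simp
    qed
    \<comment> \<open>Scaling by a positive common denominator turns the rational kernel vector into
      a natural one.\<close>
    obtain K :: int where K: "K > 0" "\<forall>v\<in>W. of_int K * y v \<in> \<int>"
      using common_denominator[OF W(1)] by blast
    define z where "z l = (if l \<in> J then nat \<lfloor>of_int K * y (Some l)\<rfloor> else 0)" for l
    have z: "rat_of_int (int (z l)) = of_int K * y (Some l)" if l: "l \<in> J" for l
    proof -
      have "of_int K * y (Some l) \<in> \<int>" using K(2) l by (simp add: W_def)
      then obtain k where k: "of_int K * y (Some l) = of_int k" by (elim Ints_cases)
      have "of_int K * y (Some l) \<ge> 0" using K(1) nonneg[OF l] by simp
      then show ?thesis using l k by (simp add: z_def)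
    qed
    have "(\<Sum>l\<in>J. int (z l) * V l r) = 0" if r: "r \<in> R" for r
    proof -
      have "rat_of_int (\<Sum>l\<in>J. int (z l) * V l r) = (\<Sum>l\<in>J. rat_of_int (int (z l)) * of_int (V l r))"
        by simp
      also have "\<dots> = (\<Sum>l\<in>J. of_int K * (y (Some l) * of_int (V l r)))"
        by (intro sum.cong refl) (simp only: z mult.assoc)
      also have "\<dots> = 0" using ker[OF r] by (simp add: sum_distrib_left[symmetric])
      finally show ?thesis by (simp only: of_int_eq_0_iff)
    qed
    then have "z \<in> lin_sols J R V (\<lambda>_. 0)" unfolding lin_sols_def by (simp add: z_def)
    moreover have "z j > 0"
    proof -
      have "rat_of_int (int (z j)) > 0" using z[OF j] y(3) K(1) by simp
      then show ?thesis by simp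
    qed
    ultimately show ?thesis using infinite_lin_sols_of_recession[OF x] fin by blast
  qed
qed

section \<open>Base expansion of the unknowns\<close>

lemma poly_int_eventually_le_power:
  "\<exists>E. \<forall>\<^sub>F n in at_top. \<bar>poly p n\<bar> \<le> (n :: int) ^ E"
proof (induction p)
  case 0
  have "\<forall>\<^sub>F n in at_top. \<bar>poly 0 n\<bar> \<le> (n :: int) ^ 1"
    using eventually_ge_at_top[of 0] by eventually_elim simp
  then show ?case by blast
next
  case (pCons a p)
  then obtain E where E: "\<forall>\<^sub>F n in at_top. \<bar>poly p n\<bar> \<le> n ^ E" by blast
  \<comment> \<open>One extra factor \<open>n\<close> comes from \<open>pCons\<close>; the other
    absorbs the 2 that arises from adding the constant term.\<close>
  have "\<forall>\<^sub>F n in at_top. \<bar>poly (pCons a p) n\<bar> \<le> n ^ (E + 2)"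
    using E eventually_ge_at_top[of "\<bar>a\<bar>"] eventually_ge_at_top[of 2]
  proof eventually_elim
    case (elim n)
    have "\<bar>poly (pCons a p) n\<bar> \<le> \<bar>a\<bar> + n * \<bar>poly p n\<bar>"
      using elim abs_triangle_ineq[of a "n * poly p n"] by (simp add: abs_mult)
    also have "\<dots> \<le> n + n * n ^ E"
      using elim by (intro add_mono mult_left_mono) auto
    also have "\<dots> \<le> 2 * (n * n ^ E)" using elim by (simp add: mult_le_cancel_left1)
    also have "\<dots> \<le> n * (n * n ^ E)" using elim by (intro mult_right_mono) auto
    finally show ?case by (simp add: power2_eq_square power_add mult_ac)
  qed
  then show ?case by blast
qed

lemma finite_poly_int_eventually_le_power:
  assumes "finite P"
  shows "\<exists>E. \<forall>\<^sub>F n in at_top. \<forall>p\<in>P. \<bar>poly p n\<bar> \<le> (n :: int) ^ E"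
  using assms
proof (induction P rule: finite_induct)
  case (insert p P)
  then obtain E E' where E: "\<forall>\<^sub>F n in at_top. \<forall>p\<in>P. \<bar>poly p n\<bar> \<le> n ^ E"
    "\<forall>\<^sub>F n in at_top. \<bar>poly p n\<bar> \<le> n ^ E'"
    using poly_int_eventually_le_power[of p] by blast
  have "\<forall>\<^sub>F n in at_top. \<forall>q\<in>insert p P. \<bar>poly q n\<bar> \<le> n ^ (max E E')"
    using E eventually_ge_at_top[of 1]
  proof eventually_elim
    case (elim n)
    have "n ^ E \<le> n ^ max E E'" "n ^ E' \<le> n ^ max E E'" using elim by (simp_all add: power_increasing)
    then show ?case using elim(1,2) by (auto intro: order_trans)
  qed
  then show ?case by blast
qed simp

section \<open>Digits in base \<open>n\<close>\<close>

lemma sum_digits_eq_mod: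
  fixes x n :: nat
  shows "(\<Sum>e<D. (x div n ^ e mod n) * n ^ e) = x mod n ^ D"
proof (induction D)
  case (Suc D)
  have "x mod n ^ Suc D = n ^ D * (x div n ^ D mod n) + x mod n ^ D"
    using mod_mult2_eq[of x "n ^ D" n] by (simp add: mult.commute)
  then show ?case using Suc by simp
qed simp

lemma sum_digits_less:
  fixes n :: nat
  assumes "\<forall>e<D. d e < n"
  shows "(\<Sum>e<D. d e * n ^ e) < n ^ D"
  using assms
proof (induction D)
  case (Suc D)
  then have "(\<Sum>e<Suc D. d e * n ^ e) < n ^ D + d D * n ^ D" by simp
  also have "\<dots> = (d D + 1) * n ^ D" by simp
  also have "\<dots> \<le> n * n ^ D" using Suc.prems by (intro mult_right_mono) auto
  finally show ?case by simp
qed simp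

lemma digit_of_sum_digits:
  fixes n :: nat
  assumes "\<forall>e<D. d e < n" "e < D"
  shows "(\<Sum>e<D. d e * n ^ e) div n ^ e mod n = d e"
  using assms
proof (induction D)
  case (Suc D)
  define v where "v = (\<Sum>e<D. d e * n ^ e)"
  have n: "n > 0" using Suc.prems(1) by (metis gr_zeroI not_less_zero zero_less_Suc)
  have v: "v < n ^ D" using Suc.prems(1) sum_digits_less[of D d n] by (simp add: v_def)
  show ?case
  proof (cases "e = D")
    case True
    then show ?thesis using n v Suc.prems(1) by (simp add: v_def[symmetric])
  next
    case False
    then have e: "e < D" using Suc.prems(2) by simp
    \<comment> \<open>\<open>n ^ D\<close> is a multiple of \<open>n ^ Suc e\<close>, so the top
      digit does not affect digit \<open>e\<close>.\<close>
    then have "n ^ D = n ^ e * (n * n ^ (D - Suc e))"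
      by (metis Suc_diff_Suc less_imp_le_nat le_add_diff_inverse power_Suc power_add)
    then have "v + d D * n ^ D = v + n * (d D * n ^ (D - Suc e)) * n ^ e" by simp
    then have "(v + d D * n ^ D) div n ^ e mod n = (n * (d D * n ^ (D - Suc e)) + v div n ^ e) mod n"
      using n div_mult_self1[of "n ^ e" v "n * (d D * n ^ (D - Suc e))"] by (simp only:) simp
    also have "\<dots> = v div n ^ e mod n" by simp
    also have "\<dots> = d e" using Suc.IH Suc.prems(1) e by (simp add: v_def)
    finally show ?thesis by (simp add: v_def)
  qed
qed simp

text \<open>Digit \<open>e\<close> of unknown \<open>j\<close> has weight \<open>n ^ e\<close>;
  multiplying by \<open>monom 1 e\<close> keeps its coefficient a polynomial in
  \<open>n\<close>.\<close>

definition digit_equations ::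
  "nat \<Rightarrow> int poly mat \<Rightarrow> int poly vec \<Rightarrow> ((nat \<times> nat \<Rightarrow> int poly) \<times> int poly) list" where
  "digit_equations m A b = map (\<lambda>r. (\<lambda>(j, e). A $$ (r, j) * monom 1 e, b $ r)) [0..<m]"

text \<open>By the bound \<open>n ^ D\<close>, \<open>D\<close> digits suffice for every solution,
  and base \<open>n\<close> expansions are unique.\<close>

lemma bij_betw_digits:
  assumes n: "n > 0"
    and bound: "\<forall>x\<in>lin_sols {..<k} {..<m} (\<lambda>j r. poly (A $$ (r, j)) n) (\<lambda>r. poly (b $ r) n). \<forall>j. int (x j) < n ^ D"
  shows "bij_betw (\<lambda>d j. \<Sum>e<D. d (j, e) * nat n ^ e)
    (box_sols ({..<k} \<times> {..<D}) (digit_equations m A b) {} n)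
    (lin_sols {..<k} {..<m} (\<lambda>j r. poly (A $$ (r, j)) n) (\<lambda>r. poly (b $ r) n))"
    (is "bij_betw ?f ?X ?Y")
proof -
  define N where "N = nat n"
  have N: "int N = n" "N > 0" using n by (simp_all add: N_def)
  have eqs: "(\<Sum>p\<in>{..<k} \<times> {..<D}. int (d p) * poly ((\<lambda>(j, e). A $$ (r, j) * monom 1 e) p) n)
      = (\<Sum>j<k. int (\<Sum>e<D. d (j, e) * N ^ e) * poly (A $$ (r, j)) n)" for d r
  proof -
    have "(\<Sum>p\<in>{..<k} \<times> {..<D}. int (d p) * poly ((\<lambda>(j, e). A $$ (r, j) * monom 1 e) p) n)
      = (\<Sum>j<k. \<Sum>e<D. int (d (j, e)) * (poly (A $$ (r, j)) n * n ^ e))"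
      by (simp add: sum.cartesian_product poly_monom case_prod_unfold)
    also have "\<dots> = (\<Sum>j<k. int (\<Sum>e<D. d (j, e) * N ^ e) * poly (A $$ (r, j)) n)"
      by (intro sum.cong refl) (simp add: sum_distrib_left sum_distrib_right N mult_ac)
    finally show ?thesis .
  qed
  have X: "d \<in> ?X \<longleftrightarrow> (\<forall>p. p \<notin> {..<k} \<times> {..<D} \<longrightarrow> d p = 0) \<and> (\<forall>p\<in>{..<k} \<times> {..<D}. d p < N) \<and>
      (\<forall>r<m. (\<Sum>j<k. int (\<Sum>e<D. d (j, e) * N ^ e) * poly (A $$ (r, j)) n) = poly (b $ r) n)" for d
  proof -
    have "int (d p) < n \<longleftrightarrow> d p < N" for p using N(1) by linarith
    then show ?thesis
      unfolding box_sols_def digit_equations_def eqs[symmetric] by simp (simp add: Ball_def)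
  qed
  define g where "g x = (\<lambda>(j, e). if j < k \<and> e < D then x j div N ^ e mod N else 0)" for x :: "nat \<Rightarrow> nat"
  have small: "x j < N ^ D" if "x \<in> ?Y" for x j
  proof -
    have "int (x j) < int (N ^ D)" using bound that by (simp add: N)
    then show ?thesis by linarith
  qed
  have fg: "?f (g x) = x" if x: "x \<in> ?Y" for x
  proof
    fix j
    show "?f (g x) j = x j"
    proof (cases "j < k")
      case True
      then have "?f (g x) j = (\<Sum>e<D. (x j div N ^ e mod N) * N ^ e)"
        by (simp add: g_def N_def)
      also have "\<dots> = x j" using small[OF x] by (simp add: sum_digits_eq_mod)
      finally show ?thesis .
    next
      case False
      then show ?thesis using x by (simp add: g_def lin_sols_def)
    qed
  qed
  show ?thesis
  proof (rule bij_betw_byWitness[where f' = g])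
    show "\<forall>d\<in>?X. g (?f d) = d"
    proof (intro ballI ext)
      fix d :: "nat \<times> nat \<Rightarrow> nat" and p :: "nat \<times> nat"
      assume "d \<in> ?X"
      then have d: "\<forall>p. p \<notin> {..<k} \<times> {..<D} \<longrightarrow> d p = 0" "\<forall>p\<in>{..<k} \<times> {..<D}. d p < N"
        unfolding X by simp_all
      obtain j e where p: "p = (j, e)" by (cases p)
      show "g (?f d) p = d p"
      proof (cases "j < k \<and> e < D")
        case True
        then show ?thesis
          using digit_of_sum_digits[of D "\<lambda>e. d (j, e)" N e] d(2) by (simp add: p g_def N_def)
      next
        case False
        then show ?thesis using d(1) by (auto simp: p g_def)
      qed
    qed
    show "\<forall>x\<in>?Y. ?f (g x) = x" using fg by blast
    show "?f ` ?X \<subseteq> ?Y"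
    proof (intro subsetI, elim imageE)
      fix x d assume "d \<in> ?X" "x = ?f d"
      then show "x \<in> ?Y" unfolding X lin_sols_def by (simp add: N_def)
    qed
    show "g ` ?Y \<subseteq> ?X"
    proof (intro subsetI, elim imageE)
      fix d x assume x: "x \<in> ?Y" and d: "d = g x"
      have "(\<Sum>e<D. d (j, e) * N ^ e) = x j" for j
        using fun_cong[OF fg[OF x], of j] by (simp add: d N_def)
      moreover have "\<forall>p. p \<notin> {..<k} \<times> {..<D} \<longrightarrow> d p = 0" "\<forall>p\<in>{..<k} \<times> {..<D}. d p < N"
        using N(2) by (auto simp: d g_def)
      ultimately show "d \<in> ?X" using x unfolding X lin_sols_def by simp
    qed
  qed
qed

section \<open>Passage to the matrix formulation\<close>

lemma bij_betw_nonneg_solutions: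
  assumes A: "A \<in> carrier_mat m k" and b: "b \<in> carrier_vec m"
  shows "bij_betw (\<lambda>x. vec k (\<lambda>j. int (x j)))
    (lin_sols {..<k} {..<m} (\<lambda>j r. poly (A $$ (r, j)) n) (\<lambda>r. poly (b $ r) n))
    (nonneg_solutions (eval_mat A n) (eval_vec b n))"
    (is "bij_betw ?f ?X ?Y")
proof -
  have dims: "dim_col (eval_mat A n) = k" "dim_row (eval_mat A n) = m" "dim_vec (eval_vec b n) = m"
    using A b by (simp_all add: eval_mat_def eval_vec_def)
  have prod: "(eval_mat A n *\<^sub>v x) $ r = (\<Sum>j<k. x $ j * poly (A $$ (r, j)) n)"
    if "r < m" "x \<in> carrier_vec k" for r x
    using that carrier_matD[OF A] by (auto simp: eval_mat_def scalar_prod_def lessThan_atLeast0 intro!: sum.cong)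
  have Y: "x \<in> ?Y \<longleftrightarrow> x \<in> carrier_vec k \<and> (\<forall>j<k. x $ j \<ge> 0) \<and>
      (\<forall>r<m. (\<Sum>j<k. x $ j * poly (A $$ (r, j)) n) = poly (b $ r) n)" for x
  proof -
    have "eval_mat A n *\<^sub>v x = eval_vec b n \<longleftrightarrow> (\<forall>r<m. (\<Sum>j<k. x $ j * poly (A $$ (r, j)) n) = poly (b $ r) n)"
      if x: "x \<in> carrier_vec k"
    proof -
      have "eval_mat A n *\<^sub>v x = eval_vec b n \<longleftrightarrow> (\<forall>r<m. (eval_mat A n *\<^sub>v x) $ r = eval_vec b n $ r)"
        using dims by (metis eq_vecI dim_mult_mat_vec)
      then show ?thesis using prod[OF _ x] b by (simp add: eval_vec_def)
    qed
    then show ?thesis unfolding nonneg_solutions_def mem_Collect_eq dims by blast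
  qed
  show ?thesis
  proof (rule bij_betw_byWitness[where f' = "\<lambda>x j. if j < k then nat (x $ j) else 0"])
    show "\<forall>x\<in>?X. (\<lambda>j. if j < k then nat (?f x $ j) else 0) = x"
      unfolding lin_sols_def by auto
    show "\<forall>x\<in>?Y. ?f (\<lambda>j. if j < k then nat (x $ j) else 0) = x"
      by (auto simp: Y intro!: eq_vecI)
    show "?f ` ?X \<subseteq> ?Y"
      unfolding Y image_subset_iff lin_sols_def by simp
    show "(\<lambda>x j. if j < k then nat (x $ j) else 0) ` ?Y \<subseteq> ?X"
    proof (intro subsetI, elim imageE)
      fix y x assume "x \<in> ?Y" and y: "y = (\<lambda>j. if j < k then nat (x $ j) else 0)"
      note x = this(1)[unfolded Y]
      have "(\<Sum>j<k. int (y j) * poly (A $$ (r, j)) n) = (\<Sum>j<k. x $ j * poly (A $$ (r, j)) n)" for r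
        using x by (intro sum.cong) (auto simp: y)
      then show "y \<in> ?X" using x by (simp add: lin_sols_def y)
    qed
  qed
qed

theorem theorem1p1:
  fixes A :: "int poly mat" and b :: "int poly vec" and m k :: nat
  assumes "A \<in> carrier_mat m k"
    and "b \<in> carrier_vec m"
    and "\<forall>\<^sub>F n in at_top. finite (nonneg_solutions (eval_mat A n) (eval_vec b n))"
  shows "(\<lambda>n. int (card (nonneg_solutions (eval_mat A n) (eval_vec b n)))) \<in> QP_eventually"
proof -
  define P where "P = (\<lambda>(r, j). A $$ (r, j)) ` ({..<m} \<times> {..<k}) \<union> (\<lambda>r. b $ r) ` {..<m}"
  have "finite P" by (simp add: P_def)
  then obtain E where E: "\<forall>\<^sub>F n in at_top. \<forall>p\<in>P. \<bar>poly p n\<bar> \<le> n ^ E"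
    using finite_poly_int_eventually_le_power by blast
  \<comment> \<open>With \<open>N = n ^ E\<close>, \<open>lin_sols_bound\<close> gives
    \<open>(2 * n ^ E) ^ 2 ^ k\<close>, which is at most \<open>n ^ ((E + 1) * 2 ^ k)\<close> once
    \<open>n \<ge> 2\<close>; the successor makes the bound strict.\<close>
  define D where "D = Suc ((E + 1) * 2 ^ k)"
  let ?X = "\<lambda>n. box_sols ({..<k} \<times> {..<D}) (digit_equations m A b) {} n"
  have "(\<lambda>n. int (card (?X n))) \<in> QP_eventually"
    by (intro QP_eventually_card_box_sols) auto
  moreover have "\<forall>\<^sub>F n in at_top. int (card (nonneg_solutions (eval_mat A n) (eval_vec b n))) = int (card (?X n))"
    using E assms(3) eventually_ge_at_top[of 2]
  proof eventually_elim
    case (elim n)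
    let ?Y = "lin_sols {..<k} {..<m} (\<lambda>j r. poly (A $$ (r, j)) n) (\<lambda>r. poly (b $ r) n)"
    note bij = bij_betw_nonneg_solutions[OF assms(1,2), of n]
    have fin: "finite ?Y" using bij_betw_finite[OF bij] elim(2) by blast
    have "\<forall>x\<in>?Y. \<forall>j. int (x j) < n ^ D"
    proof (intro ballI allI)
      fix x j assume x: "x \<in> ?Y"
      have "int (x j) \<le> (2 * n ^ E) ^ 2 ^ card {..<k}"
        by (rule lin_sols_bound[OF _ _ fin _ _ _ x]) (use elim(1,3) in \<open>auto simp: P_def\<close>)
      also have "\<dots> \<le> (n * n ^ E) ^ 2 ^ card {..<k}"
        using elim(3) by (intro power_mono mult_right_mono) auto
      also have "\<dots> = n ^ ((E + 1) * 2 ^ k)"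
        by (simp only: power_mult power_Suc Suc_eq_plus1[symmetric] card_lessThan)
      also have "\<dots> < n ^ D" using elim(3) by (simp add: D_def)
      finally show "int (x j) < n ^ D" .
    qed
    then have "card (?X n) = card ?Y"
      using elim(3) by (intro bij_betw_same_card[OF bij_betw_digits]) auto
    also have "\<dots> = card (nonneg_solutions (eval_mat A n) (eval_vec b n))"
      by (rule bij_betw_same_card[OF bij])
    finally show ?case by simp
  qed
  ultimately show ?thesis by (rule QP_eventually_cong)
qed

end
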